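(* Let $M$ be a countable ultrahomogeneous structure and let $G=\mathrm{Aut}(M)$. Suppose that there exists $g\in G$ such that for every $n\in\mathbb{N}$ and any partial automorphisms $\phi_i\colon A_i\to B_i$ and $\psi_i\colon C_i\to D_i$, $i\le n$, of $M$, there are $k,m\in\mathbb{Z}$ such that, for each $i\le n$, $g^{k}\phi_i g^{-k}\cup g^{m}\psi_i g^{-m}$ can be extended to a single automorphism of $M$. Then for each $n\in\mathbb{N}$ the group $G^n$ is cyclically generated by $((g,\ldots,g),\bar b)$ for some $\bar b\in G^n$, and $L_0(G)$ is cyclically generated by $(f_g,b)$ for some $b\in L_0(G)$. Moreover, if $M$ has no algebraicity and $g$ has no cycles, then for each $n\in\mathbb{N}$ one can find such $\bar b\in G^n$ (respectively, such $b\in L_0(G)$) for which, in addition, $(g,\ldots,g)$ and $\bar b$ (respectively, $f_g$ and $b$) generate the free group (i.e. freely generate a free group of rank 2).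
   Context: $\mathbb{N}=\{1,2,\ldots\}$. Structures are nonempty. A countable structure $M$ is ultrahomogeneous if every isomorphism between finite substructures of $M$ extends to an automorphism of $M$. $\mathrm{Aut}(M)$ is the automorphism group of $M$ with the pointwise convergence topology ($M$ discrete); it is a Polish group. A partial automorphism of $M$ is a bijection $p\colon A\to B$ between finite sets $A,B\subseteq M$ that can be extended to an automorphism of $M$. For $g\in\mathrm{Aut}(M)$, $g^k p g^{-k}$ denotes the partial automorphism $g^k(A)\to g^k(B)$. For $X\subseteq M$, $\mathrm{Aut}_X(M)$ is the pointwise stabilizer of $X$. $M$ has no algebraicity if for any finite $X,Y\subseteq M$ with $Y\ne\emptyset$ and $X\cap Y=\emptyset$, the orbit $\mathrm{Aut}_X(M).Y$ is infinite. $g\in\mathrm{Aut}(M)$ has no cycles if $g^n(x)\ne x$ for all $x\in M$ and $n\ge1$. For a Polish group $H$ and $g,h\in H$, the pair $(g,h)$ cyclically generates $H$ if $\{g^l h g^{-l}: l\in\mathbb{Z}\}$ is dense in $H$. For a Polish group $G$, $L_0(G)=L_0([0,1],\lambda;G)$ ($\lambda$ Lebesgue measure) is the group of ($\lambda$-a.e. equivalence classes of) measurable functions $[0,1]\to G$ with pointwise multiplication and the topology of convergence in measure: basic neighbourhoods of $h$ are $\{f: \lambda(\{x: d(f(x),h(x))<\delta\})>1-\epsilon\}$, $\delta,\epsilon>0$, for a fixed compatible complete metric $d$ on $G$. It is a Polish group. For $g\in G$, $f_g\in L_0(G)$ is the constant function with value $g$. *)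

theory Defs
  imports
    "HOL-Analysis.Analysis"
    "HOL-Algebra.Product_Groups"
begin

section \<open>First-order structures\<close>

text \<open>The universe of a structure is the whole type \<open>'a\<close>, so it is automatically nonempty;
  countability is the sort constraint \<open>'a :: countable\<close>. The language consists of the sets \<open>funs\<close>
  and \<open>rels\<close> of symbols (either may be empty) with arities; constants are nullary function symbols.
  Interpretations are only ever consulted on argument lists of the correct length.\<close>

record ('f, 'r, 'a) fo_structure =
  funs :: "'f set"
  rels :: "'r set"
  fun_arity :: "'f \<Rightarrow> nat"
  rel_arity :: "'r \<Rightarrow> nat"
  fun_interp :: "'f \<Rightarrow> 'a list \<Rightarrow> 'a"
  rel_interp :: "'r \<Rightarrow> 'a list \<Rightarrow> bool"

definition substructure :: "('f, 'r, 'a) fo_structure \<Rightarrow> 'a set \<Rightarrow> bool" where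
  "substructure M A \<longleftrightarrow> A \<noteq> {} \<and>
     (\<forall>f\<in>funs M. \<forall>xs. set xs \<subseteq> A \<and> length xs = fun_arity M f \<longrightarrow> fun_interp M f xs \<in> A)"

definition isomorphism_between ::
    "('f, 'r, 'a) fo_structure \<Rightarrow> 'a set \<Rightarrow> 'a set \<Rightarrow> ('a \<Rightarrow> 'a) \<Rightarrow> bool" where
  "isomorphism_between M A B p \<longleftrightarrow> bij_betw p A B \<and>
     (\<forall>f\<in>funs M. \<forall>xs. set xs \<subseteq> A \<and> length xs = fun_arity M f \<longrightarrow>
        p (fun_interp M f xs) = fun_interp M f (map p xs)) \<and>
     (\<forall>r\<in>rels M. \<forall>xs. set xs \<subseteq> A \<and> length xs = rel_arity M r \<longrightarrow>
        (rel_interp M r (map p xs) \<longleftrightarrow> rel_interp M r xs))"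

definition automorphisms :: "('f, 'r, 'a) fo_structure \<Rightarrow> ('a \<Rightarrow> 'a) set" where
  "automorphisms M = {h. isomorphism_between M UNIV UNIV h}"

definition ultrahomogeneous :: "('f, 'r, 'a) fo_structure \<Rightarrow> bool" where
  "ultrahomogeneous M \<longleftrightarrow>
     (\<forall>A B p. finite A \<and> finite B \<and> substructure M A \<and> substructure M B \<and>
        isomorphism_between M A B p \<longrightarrow> (\<exists>h\<in>automorphisms M. \<forall>x\<in>A. h x = p x))"

section \<open>The automorphism group\<close>

definition aut_group :: "('f, 'r, 'a) fo_structure \<Rightarrow> ('a \<Rightarrow> 'a) monoid" where
  "aut_group M = \<lparr>carrier = automorphisms M, mult = (\<circ>), one = id\<rparr>"

definition aut_topology :: "('f, 'r, 'a) fo_structure \<Rightarrow> ('a \<Rightarrow> 'a) topology" where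
  "aut_topology M =
     subtopology (product_topology (\<lambda>_. discrete_topology UNIV) UNIV) (automorphisms M)"

text \<open>A partial automorphism is represented by its graph; \<open>A\<close> and \<open>B\<close> are the domain and range
  of the relation. Being contained in the graph of a bijection, it is itself the graph of a bijection.\<close>

definition extends_graph :: "('a \<Rightarrow> 'a) \<Rightarrow> ('a \<times> 'a) set \<Rightarrow> bool" where
  "extends_graph h p \<longleftrightarrow> (\<forall>(x, y)\<in>p. h x = y)"

definition partial_automorphism :: "('f, 'r, 'a) fo_structure \<Rightarrow> ('a \<times> 'a) set \<Rightarrow> bool" where
  "partial_automorphism M p \<longleftrightarrow> finite p \<and> (\<exists>h\<in>automorphisms M. extends_graph h p)"

text \<open>The graph of \<open>g\<^sup>k p g\<^sup>-\<^sup>k\<close> is the image of the graph of \<open>p\<close> under \<open>g\<^sup>k \<times> g\<^sup>k\<close>.\<close>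

definition conj_partial ::
    "('f, 'r, 'a) fo_structure \<Rightarrow> ('a \<Rightarrow> 'a) \<Rightarrow> int \<Rightarrow> ('a \<times> 'a) set \<Rightarrow> ('a \<times> 'a) set" where
  "conj_partial M g k p =
     map_prod (g [^]\<^bsub>aut_group M\<^esub> k) (g [^]\<^bsub>aut_group M\<^esub> k) ` p"

definition pointwise_stabilizer :: "('f, 'r, 'a) fo_structure \<Rightarrow> 'a set \<Rightarrow> ('a \<Rightarrow> 'a) set" where
  "pointwise_stabilizer M X = {h \<in> automorphisms M. \<forall>x\<in>X. h x = x}"

definition no_algebraicity :: "('f, 'r, 'a) fo_structure \<Rightarrow> bool" where
  "no_algebraicity M \<longleftrightarrow>
     (\<forall>X Y. finite X \<and> finite Y \<and> Y \<noteq> {} \<and> X \<inter> Y = {} \<longrightarrow>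
        infinite {h ` Y | h. h \<in> pointwise_stabilizer M X})"

definition no_cycles :: "('a \<Rightarrow> 'a) \<Rightarrow> bool" where
  "no_cycles g \<longleftrightarrow> (\<forall>x. \<forall>n\<ge>1. (g ^^ n) x \<noteq> x)"

section \<open>Cyclic generation and free generation\<close>

definition cyclically_generates :: "('g, 'm) monoid_scheme \<Rightarrow> 'g topology \<Rightarrow> 'g \<Rightarrow> 'g \<Rightarrow> bool" where
  "cyclically_generates H T g h \<longleftrightarrow> g \<in> carrier H \<and> h \<in> carrier H \<and>
     T closure_of {g [^]\<^bsub>H\<^esub> l \<otimes>\<^bsub>H\<^esub> h \<otimes>\<^bsub>H\<^esub> g [^]\<^bsub>H\<^esub> (- l) | l :: int. True} = carrier H"

text \<open>A word in two letters and their inverses is a list of pairs: the first component selects the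
  letter (\<open>True\<close> for \<open>a\<close>, \<open>False\<close> for \<open>b\<close>), the second one its exponent (\<open>True\<close> for \<open>1\<close>, \<open>False\<close>
  for \<open>-1\<close>).\<close>

definition reduced_word :: "(bool \<times> bool) list \<Rightarrow> bool" where
  "reduced_word w \<longleftrightarrow> successively (\<lambda>(s, e) (t, f). s = t \<longrightarrow> e = f) w"

definition letter_value :: "('g, 'm) monoid_scheme \<Rightarrow> 'g \<Rightarrow> 'g \<Rightarrow> bool \<times> bool \<Rightarrow> 'g" where
  "letter_value H a b = (\<lambda>(s, e). let x = if s then a else b in if e then x else inv\<^bsub>H\<^esub> x)"

definition word_value :: "('g, 'm) monoid_scheme \<Rightarrow> 'g \<Rightarrow> 'g \<Rightarrow> (bool \<times> bool) list \<Rightarrow> 'g" where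
  "word_value H a b w = foldr (\<lambda>l y. letter_value H a b l \<otimes>\<^bsub>H\<^esub> y) w \<one>\<^bsub>H\<^esub>"

definition freely_generate :: "('g, 'm) monoid_scheme \<Rightarrow> 'g \<Rightarrow> 'g \<Rightarrow> bool" where
  "freely_generate H a b \<longleftrightarrow> a \<in> carrier H \<and> b \<in> carrier H \<and>
     (\<forall>w. reduced_word w \<and> w \<noteq> [] \<longrightarrow> word_value H a b w \<noteq> \<one>\<^bsub>H\<^esub>)"

section \<open>The group \<open>G\<^sup>n\<close>\<close>

definition power_group :: "nat \<Rightarrow> ('g, 'm) monoid_scheme \<Rightarrow> (nat \<Rightarrow> 'g) monoid" where
  "power_group n G = product_group {1..n} (\<lambda>_. G)"

definition power_topology :: "nat \<Rightarrow> 'g topology \<Rightarrow> (nat \<Rightarrow> 'g) topology" where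
  "power_topology n T = product_topology (\<lambda>_. T) {1..n}"

section \<open>The group \<open>L\<^sub>0(G)\<close>\<close>

text \<open>A topological group is given by a group \<open>G\<close> and a topology \<open>T\<close> with \<open>topspace T = carrier G\<close>.\<close>

abbreviation unit_interval_measure :: "real measure" where
  "unit_interval_measure \<equiv> lebesgue_on {0..1}"

definition borel_of_topology :: "'g topology \<Rightarrow> 'g measure" where
  "borel_of_topology T = sigma (topspace T) {U. openin T U}"

text \<open>Maps are total on \<^typ>\<open>real\<close>, but only their values on \<open>[0,1]\<close> matter: both measurability and
  the almost-everywhere equality below refer to the measure space \<open>[0,1]\<close>.\<close>

definition L0_maps :: "'g topology \<Rightarrow> (real \<Rightarrow> 'g) set" where
  "L0_maps T = measurable unit_interval_measure (borel_of_topology T)"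

definition L0_rel :: "'g topology \<Rightarrow> ((real \<Rightarrow> 'g) \<times> (real \<Rightarrow> 'g)) set" where
  "L0_rel T = {(f, h). f \<in> L0_maps T \<and> h \<in> L0_maps T \<and> (AE x in unit_interval_measure. f x = h x)}"

definition L0_group ::
    "('g, 'm) monoid_scheme \<Rightarrow> 'g topology \<Rightarrow> (real \<Rightarrow> 'g) set monoid" where
  "L0_group G T =
     \<lparr>carrier = L0_maps T // L0_rel T,
      mult = (\<lambda>F H. \<Union>f\<in>F. \<Union>h\<in>H. L0_rel T `` {\<lambda>x. f x \<otimes>\<^bsub>G\<^esub> h x}),
      one = L0_rel T `` {\<lambda>_. \<one>\<^bsub>G\<^esub>}\<rparr>"

definition L0_const :: "'g topology \<Rightarrow> 'g \<Rightarrow> (real \<Rightarrow> 'g) set" where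
  "L0_const T g = L0_rel T `` {\<lambda>_. g}"

definition compatible_complete_metric :: "'g topology \<Rightarrow> ('g \<Rightarrow> 'g \<Rightarrow> real) \<Rightarrow> bool" where
  "compatible_complete_metric T d \<longleftrightarrow> Metric_space (topspace T) d \<and>
     Metric_space.mtopology (topspace T) d = T \<and> Metric_space.mcomplete (topspace T) d"

definition L0_nbhd ::
    "'g topology \<Rightarrow> ('g \<Rightarrow> 'g \<Rightarrow> real) \<Rightarrow> (real \<Rightarrow> 'g) set \<Rightarrow> real \<Rightarrow> real \<Rightarrow> (real \<Rightarrow> 'g) set set" where
  "L0_nbhd T d H \<delta> \<epsilon> = {F \<in> L0_maps T // L0_rel T.
     \<exists>f\<in>F. \<exists>h\<in>H. measure unit_interval_measure {x \<in> {0..1}. d (f x) (h x) < \<delta>} > 1 - \<epsilon>}"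

definition L0_open ::
    "'g topology \<Rightarrow> ('g \<Rightarrow> 'g \<Rightarrow> real) \<Rightarrow> (real \<Rightarrow> 'g) set set \<Rightarrow> bool" where
  "L0_open T d U \<longleftrightarrow> U \<subseteq> L0_maps T // L0_rel T \<and>
     (\<forall>H\<in>U. \<exists>\<delta>>0. \<exists>\<epsilon>>0. L0_nbhd T d H \<delta> \<epsilon> \<subseteq> U)"

definition L0_topology ::
    "'g topology \<Rightarrow> ('g \<Rightarrow> 'g \<Rightarrow> real) \<Rightarrow> (real \<Rightarrow> 'g) set topology" where
  "L0_topology T d = topology (L0_open T d)"

section \<open>Well-definedness\<close>

text \<open>\<^const>\<open>L0_topology\<close> and the quantification over compatible complete metrics are meaningful
  for automorphism groups: \<^const>\<open>L0_open\<close> is a topology, and such metrics exist.\<close>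

lemma L0_dist_measurable:
  assumes d: "compatible_complete_metric T d" and T: "second_countable T"
    and f: "f \<in> L0_maps T" and h: "h \<in> L0_maps T"
  shows "{x \<in> {0..1}. d (f x) (h x) < \<delta>} \<in> sets unit_interval_measure"
proof -
  let ?N = unit_interval_measure
  interpret Metric_space "topspace T" d
    using d by (simp add: compatible_complete_metric_def)
  have mT: "mtopology = T"
    using d by (simp add: compatible_complete_metric_def)
  obtain D where D: "countable D" "D \<subseteq> topspace T" "T closure_of D = topspace T"
    using second_countable_imp_separable_space[OF T] by (auto simp: separable_space_def)
  have space: "space ?N = {0..1}" by simp
  have val: "k x \<in> topspace T" if "k \<in> L0_maps T" "x \<in> {0..1}" for k x
  proof -
    have "space (borel_of_topology T) = topspace T"
      by (simp add: borel_of_topology_def space_measure_of_conv)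
    with that measurable_space[of k ?N "borel_of_topology T" x] show ?thesis
      by (simp add: L0_maps_def)
  qed
  have ball: "{x \<in> {0..1}. k x \<in> mball p r} \<in> sets ?N" if k: "k \<in> L0_maps T" for k p r
  proof -
    have "openin T (mball p r)"
      using openin_mball[of p r] mT by simp
    then have "mball p r \<in> sets (borel_of_topology T)"
      unfolding borel_of_topology_def
      by (subst sets_measure_of) (auto dest: openin_subset)
    with k have "k -` mball p r \<inter> space ?N \<in> sets ?N"
      unfolding L0_maps_def by (rule measurable_sets)
    moreover have "k -` mball p r \<inter> space ?N = {x \<in> {0..1}. k x \<in> mball p r}"
      by auto
    ultimately show ?thesis by simp
  qed
  have eq: "{x \<in> {0..1}. d (f x) (h x) < \<delta>} =
      (\<Union>p\<in>D. \<Union>r\<in>\<rat>. {x \<in> {0..1}. f x \<in> mball p r} \<inter> {x \<in> {0..1}. h x \<in> mball p (\<delta> - r)})"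
    (is "?L = ?R")
  proof (intro equalityI subsetI)
    fix x assume "x \<in> ?L"
    then have x: "x \<in> {0..1}" "d (f x) (h x) < \<delta>" by auto
    have fx: "f x \<in> topspace T" and hx: "h x \<in> topspace T"
      using val f h x by auto
    define e where "e = (\<delta> - d (f x) (h x)) / 2"
    have e: "e > 0" using x by (simp add: e_def)
    have "f x \<in> mtopology closure_of D" using fx D mT by simp
    then obtain p where p: "p \<in> D" "p \<in> mball (f x) e"
      using e by (auto simp: metric_closure_of)
    have pT: "p \<in> topspace T" using p D by auto
    have pf: "d p (f x) < e" using p(2) by (simp add: commute)
    obtain r where r: "r \<in> \<rat>" "d p (f x) < r" "r < e"
      using Rats_dense_in_real[OF pf] by auto
    have "d p (h x) \<le> d p (f x) + d (f x) (h x)"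
      using triangle pT fx hx by blast
    also have "\<dots> < e + d (f x) (h x)" using pf by simp
    also have "\<dots> = \<delta> - e" by (simp add: e_def field_simps)
    also have "\<dots> < \<delta> - r" using r by simp
    finally show "x \<in> ?R" using p r x fx hx pT by auto
  next
    fix x assume "x \<in> ?R"
    then obtain p r where *: "x \<in> {0..1}" "p \<in> topspace T" "f x \<in> topspace T" "h x \<in> topspace T"
        "d p (f x) < r" "d p (h x) < \<delta> - r"
      by auto
    have "d (f x) (h x) \<le> d (f x) p + d p (h x)"
      using triangle * by blast
    with * show "x \<in> ?L" by (auto simp: commute)
  qed
  show ?thesis
    unfolding eq using D(1) countable_rat
    by (intro sets.countable_UN'' sets.Int ball f h)
qed

lemma istopology_L0_open:
  assumes d: "compatible_complete_metric T d" and T: "second_countable T"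
  shows "istopology (L0_open T d)"
proof -
  have sub: "H \<subseteq> L0_maps T" if "H \<in> L0_maps T // L0_rel T" for H
    using that by (auto simp: quotient_def L0_rel_def)
  have mono: "L0_nbhd T d H \<delta> \<epsilon> \<subseteq> L0_nbhd T d H \<delta>' \<epsilon>'"
    if H: "H \<in> L0_maps T // L0_rel T" and le: "\<delta> \<le> \<delta>'" "\<epsilon> \<le> \<epsilon>'" for H \<delta> \<epsilon> \<delta>' \<epsilon>'
  proof
    fix F assume F: "F \<in> L0_nbhd T d H \<delta> \<epsilon>"
    then obtain f h where fh: "F \<in> L0_maps T // L0_rel T" "f \<in> F" "h \<in> H"
        "measure unit_interval_measure {x \<in> {0..1}. d (f x) (h x) < \<delta>} > 1 - \<epsilon>"
      by (auto simp: L0_nbhd_def)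
    have fm: "f \<in> L0_maps T" "h \<in> L0_maps T" using fh sub H by blast+
    have fin: "finite_measure unit_interval_measure"
      by (rule finite_measureI) (simp add: emeasure_restrict_space)
    have "measure unit_interval_measure {x \<in> {0..1}. d (f x) (h x) < \<delta>}
        \<le> measure unit_interval_measure {x \<in> {0..1}. d (f x) (h x) < \<delta>'}"
      by (intro finite_measure.finite_measure_mono[OF fin] L0_dist_measurable[OF d T] fm)
        (use le in auto)
    then have "measure unit_interval_measure {x \<in> {0..1}. d (f x) (h x) < \<delta>'} > 1 - \<epsilon>'"
      using fh(4) le by linarith
    then show "F \<in> L0_nbhd T d H \<delta>' \<epsilon>'"
      using fh(1-3) unfolding L0_nbhd_def by blast
  qed
  have Int: "L0_open T d (U \<inter> V)" if U: "L0_open T d U" and V: "L0_open T d V" for U V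
    unfolding L0_open_def
  proof (intro conjI ballI)
    show "U \<inter> V \<subseteq> L0_maps T // L0_rel T"
      using U by (auto simp: L0_open_def)
  next
    fix H assume H: "H \<in> U \<inter> V"
    then have HQ: "H \<in> L0_maps T // L0_rel T"
      using U by (auto simp: L0_open_def)
    obtain a e where 1: "a > 0" "e > 0" "L0_nbhd T d H a e \<subseteq> U"
      using H U unfolding L0_open_def by blast
    obtain a' e' where 2: "a' > 0" "e' > 0" "L0_nbhd T d H a' e' \<subseteq> V"
      using H V unfolding L0_open_def by blast
    have "L0_nbhd T d H (min a a') (min e e') \<subseteq> U \<inter> V"
      using mono[OF HQ, of "min a a'" a "min e e'" e] mono[OF HQ, of "min a a'" a' "min e e'" e'] 1 2
      by auto
    then show "\<exists>\<delta>>0. \<exists>\<epsilon>>0. L0_nbhd T d H \<delta> \<epsilon> \<subseteq> U \<inter> V"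
      using 1 2 by (meson min_less_iff_conj)
  qed
  have Un: "L0_open T d (\<Union>\<U>)" if "\<forall>U\<in>\<U>. L0_open T d U" for \<U>
    using that unfolding L0_open_def by (meson Union_iff Union_least Union_upper order_trans)
  show ?thesis
    unfolding istopology_def using Int Un by blast
qed

lemma topspace_aut_topology [simp]: "topspace (aut_topology M) = automorphisms M"
  by (simp add: aut_topology_def)

lemma second_countable_aut_topology:
  fixes M :: "('f, 'r, 'a :: countable) fo_structure"
  shows "second_countable (aut_topology M)"
proof -
  let ?P = "product_topology (\<lambda>_ :: 'a. discrete_topology (UNIV :: 'a set)) UNIV"
  define B :: "('a \<times> 'a) list \<Rightarrow> ('a \<Rightarrow> 'a) set" where "B l = {h. \<forall>(x, y)\<in>set l. h x = y}" for l
  have op: "openin ?P (B l)" for l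
  proof (induction l)
    case Nil
    have "B [] = topspace ?P" by (simp add: B_def)
    then show ?case by (metis openin_topspace)
  next
    case (Cons q l)
    have "openin ?P {h \<in> topspace ?P. h (fst q) \<in> {snd q}}"
      by (rule openin_continuous_map_preimage[where Y = "discrete_topology UNIV"])
        (auto intro: continuous_map_product_projection)
    moreover have "B (q # l) = {h \<in> topspace ?P. h (fst q) \<in> {snd q}} \<inter> B l"
      by (auto simp: B_def)
    ultimately show ?case using Cons.IH by auto
  qed
  have base: "\<exists>V\<in>range B. h \<in> V \<and> V \<subseteq> U" if U: "openin ?P U" "h \<in> U" for U h
  proof -
    obtain X where X: "finite {i \<in> UNIV. X i \<noteq> topspace (discrete_topology (UNIV :: 'a set))}"
        "h \<in> Pi\<^sub>E UNIV X" "Pi\<^sub>E UNIV X \<subseteq> U"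
      using U unfolding openin_product_topology_alt by blast
    then have "finite {i. X i \<noteq> UNIV}" by simp
    then obtain xs where xs: "set xs = {i. X i \<noteq> UNIV}"
      using finite_list by blast
    have "k \<in> U" if "k \<in> B (map (\<lambda>x. (x, h x)) xs)" for k
    proof -
      have "k i \<in> X i" for i
      proof (cases "X i = UNIV")
        case False
        then have "k i = h i" using that xs by (auto simp: B_def)
        then show ?thesis using X(2) by (auto simp: PiE_iff)
      qed simp
      then show ?thesis using X(3) by auto
    qed
    moreover have "h \<in> B (map (\<lambda>x. (x, h x)) xs)" by (auto simp: B_def)
    ultimately show ?thesis by blast
  qed
  have "second_countable ?P"
    unfolding second_countable_def
    using op base by (intro exI[of _ "range B"]) auto
  then show ?thesis
    unfolding aut_topology_def by (rule second_countable_subtopology)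
qed

lemma completely_metrizable_aut_topology:
  fixes M :: "('f, 'r, 'a :: countable) fo_structure"
  shows "completely_metrizable_space (aut_topology M)"
proof -
  let ?P = "product_topology (\<lambda>_ :: 'a. discrete_topology (UNIV :: 'a set)) UNIV"
  have top: "topspace ?P = UNIV" by simp
  have P: "completely_metrizable_space ?P"
    by (simp add: completely_metrizable_space_product_topology
        completely_metrizable_space_discrete_topology)
  have val: "openin ?P {h. h x = y}" for x y
  proof -
    have "openin ?P {h \<in> topspace ?P. h x \<in> {y}}"
      by (rule openin_continuous_map_preimage[where Y = "discrete_topology UNIV"])
        (auto intro: continuous_map_product_projection)
    then show ?thesis by simp
  qed
  have fin: "openin ?P {h. Q (map h xs)}" for xs and Q :: "'a list \<Rightarrow> bool"
  proof -
    have "{h. Q (map h xs)} = (\<Union>ys\<in>{ys. Q ys \<and> length ys = length xs}.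
        \<Inter>i\<in>{..<length xs}. {h. h (xs ! i) = ys ! i}) \<inter> topspace ?P"
    proof (intro equalityI subsetI)
      fix h assume "h \<in> {h. Q (map h xs)}"
      then show "h \<in> (\<Union>ys\<in>{ys. Q ys \<and> length ys = length xs}.
          \<Inter>i\<in>{..<length xs}. {h. h (xs ! i) = ys ! i}) \<inter> topspace ?P"
        by (auto intro!: exI[of _ "map h xs"])
    next
      fix h assume "h \<in> (\<Union>ys\<in>{ys. Q ys \<and> length ys = length xs}.
          \<Inter>i\<in>{..<length xs}. {h. h (xs ! i) = ys ! i}) \<inter> topspace ?P"
      then obtain ys where ys: "Q ys" "length ys = length xs" "\<And>i. i < length xs \<Longrightarrow> h (xs ! i) = ys ! i"
        by auto
      then have "map h xs = ys" by (simp add: list_eq_iff_nth_eq)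
      then show "h \<in> {h. Q (map h xs)}" using ys by simp
    qed
    moreover have "openin ?P (\<Inter>i\<in>{..<length xs}. {h. h (xs ! i) = ys ! i})" for ys
      by (cases "xs = []") (use val openin_topspace[of ?P] in \<open>auto intro!: openin_INT2\<close>)
    ultimately show ?thesis by auto
  qed
  have gd: "gdelta_in ?P {h. \<forall>i. R i h}" if R: "\<And>i :: 'i :: countable. openin ?P {h. R i h}" for R
  proof -
    have eq: "{h. \<forall>i. R i h} = \<Inter>(range (\<lambda>i. {h. R i h}))" by auto
    show ?thesis
      unfolding eq by (rule gdelta_in_Inter) (use R in \<open>auto intro: open_imp_gdelta_in\<close>)
  qed
  have gd_closed: "gdelta_in ?P {h. \<forall>i\<in>I. R i h}"
    if R: "\<And>i. i \<in> I \<Longrightarrow> openin ?P {h. \<not> R i h}" for I :: "'i set" and R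
  proof -
    have "closedin ?P {h. \<forall>i\<in>I. R i h}"
    proof -
      have "openin ?P (\<Union>i\<in>I. {h. \<not> R i h})" using R by auto
      moreover have "topspace ?P - {h. \<forall>i\<in>I. R i h} = (\<Union>i\<in>I. {h. \<not> R i h})" by auto
      ultimately show ?thesis unfolding closedin_def by simp
    qed
    then show ?thesis
      using P completely_metrizable_imp_metrizable_space closed_imp_gdelta_in by blast
  qed
  have 1: "gdelta_in ?P {h. \<forall>(x, y)\<in>UNIV. x \<noteq> y \<longrightarrow> h x \<noteq> h y}"
  proof -
    have "openin ?P {h. x \<noteq> y \<longrightarrow> h x \<noteq> h y}" for x y
      using fin[of "\<lambda>zs. x \<noteq> y \<longrightarrow> zs ! 0 \<noteq> zs ! 1" "[x, y]"] by simp
    then show ?thesis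
      using gd[of "\<lambda>q h. fst q \<noteq> snd q \<longrightarrow> h (fst q) \<noteq> h (snd q)"] by (simp add: case_prod_beta)
  qed
  have 2: "gdelta_in ?P {h. \<forall>y. \<exists>x. h x = y}"
  proof (rule gd)
    fix y :: 'a
    have "{h :: 'a \<Rightarrow> 'a. \<exists>x. h x = y} = (\<Union>x. {h. h x = y})" by auto
    then show "openin ?P {h. \<exists>x. h x = y}" using val by auto
  qed
  have 3: "gdelta_in ?P {h. \<forall>(f, xs)\<in>{(f, xs). f \<in> funs M \<and> length xs = fun_arity M f}.
      h (fun_interp M f xs) = fun_interp M f (map h xs)}"
    unfolding case_prod_beta
  proof (rule gd_closed)
    fix q :: "'f \<times> 'a list"
    show "openin ?P {h. h (fun_interp M (fst q) (snd q)) \<noteq> fun_interp M (fst q) (map h (snd q))}"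
      using fin[of "\<lambda>zs. hd zs \<noteq> fun_interp M (fst q) (tl zs)"
          "fun_interp M (fst q) (snd q) # snd q"] by simp
  qed
  have 4: "gdelta_in ?P {h. \<forall>(r, xs)\<in>{(r, xs). r \<in> rels M \<and> length xs = rel_arity M r}.
      rel_interp M r (map h xs) \<longleftrightarrow> rel_interp M r xs}"
    unfolding case_prod_beta
  proof (rule gd_closed)
    fix q :: "'r \<times> 'a list"
    show "openin ?P {h. (rel_interp M (fst q) (map h (snd q))) \<noteq> rel_interp M (fst q) (snd q)}"
      using fin[of "\<lambda>zs. rel_interp M (fst q) zs \<noteq> rel_interp M (fst q) (snd q)" "snd q"] by simp
  qed
  have bij: "bij h \<longleftrightarrow> (\<forall>(x, y)\<in>UNIV. x \<noteq> y \<longrightarrow> h x \<noteq> h y) \<and> (\<forall>y. \<exists>x. h x = y)"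
    for h :: "'a \<Rightarrow> 'a"
  proof -
    have "inj h \<longleftrightarrow> (\<forall>(x, y)\<in>UNIV. x \<noteq> y \<longrightarrow> h x \<noteq> h y)" by (auto simp: inj_def)
    moreover have "surj h \<longleftrightarrow> (\<forall>y. \<exists>x. h x = y)" unfolding surj_def by metis
    ultimately show ?thesis by (simp add: bij_def)
  qed
  have "automorphisms M =
      ({h. \<forall>(x, y)\<in>UNIV. x \<noteq> y \<longrightarrow> h x \<noteq> h y} \<inter> {h. \<forall>y. \<exists>x. h x = y}) \<inter>
      ({h. \<forall>(f, xs)\<in>{(f, xs). f \<in> funs M \<and> length xs = fun_arity M f}.
          h (fun_interp M f xs) = fun_interp M f (map h xs)} \<inter>
       {h. \<forall>(r, xs)\<in>{(r, xs). r \<in> rels M \<and> length xs = rel_arity M r}.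
          rel_interp M r (map h xs) \<longleftrightarrow> rel_interp M r xs})"
    unfolding automorphisms_def isomorphism_between_def bij by auto
  then have "gdelta_in ?P (automorphisms M)"
    using 1 2 3 4 by (simp only: gdelta_in_Int)
  then show ?thesis
    unfolding aut_topology_def using P completely_metrizable_space_gdelta_in by blast
qed

lemma ex_compatible_complete_metric:
  fixes M :: "('f, 'r, 'a :: countable) fo_structure"
  shows "\<exists>d. compatible_complete_metric (aut_topology M) d"
  using completely_metrizable_aut_topology[of M]
  unfolding completely_metrizable_space_def compatible_complete_metric_def
  by (metis Metric_space.topspace_mtopology)

end

theory Submission
  imports Defs
begin

text \<open>
  Conjugating by a power of \<open>g\<close>, the hypothesis says that for finitely many pairs of basic open sets of
  \<open>Aut(M)\<close> one and the same power of \<open>g\<close> conjugates a point of the first set of each pair into the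
  second one (\<open>conjugation_transitive\<close>). This is topological transitivity of conjugation by
  \<open>(g, \<dots>, g)\<close> on every finite power, and a point with dense orbit is then found as in Baire's theorem:
  finite partial automorphisms are extended step by step, and each step takes care of one of countably many
  targets.

  Both groups are served by one such construction (\<open>generic_map\<close>). Points \<open>x\<close> of an index set are
  sorted into finer and finer finite partitions, and the automorphisms \<open>b x\<close> are built simultaneously, the
  finite part known at stage \<open>n\<close> depending only on the cell of \<open>x\<close> in the \<open>n\<close>-th partition. A target assigns a
  partial automorphism to each cell of some partition; since there are finitely many cells, one power
  of \<open>g\<close> serves them all. With \<open>{1..n}\<close> partitioned into points this yields a dense orbit in \<open>G\<^sup>n\<close>.
  With \<open>[0,1]\<close> partitioned into dyadic intervals it yields a map \<open>b\<close>, measurable since \<open>b x a\<close> is for each \<open>a\<close>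
  a dyadic step function of \<open>x\<close>, some conjugate of which lies uniformly in \<open>x\<close> in any prescribed
  neighbourhood of any prescribed dyadic step function; as step functions are dense for convergence in
  measure (\<open>step_approximation\<close>), the orbit of \<open>b\<close> is dense in \<open>L\<^sub>0(G)\<close>.

  Freeness follows from density. If a word \<open>w\<close> is trivial on \<open>(g, b)\<close>, then it is trivial on every
  \<open>(g, g\<^sup>l b g\<^sup>-\<^sup>l)\<close>. But with no algebraicity and no cycles, some automorphism \<open>h\<close> satisfies
  \<open>w(g, h)(x) \<noteq> x\<close> for some \<open>x\<close>, and this inequality only depends on the behaviour of \<open>h\<close> on a finite
  set (\<open>ex_word_moves_point\<close>), on which some conjugate of \<open>b\<close> agrees with \<open>h\<close>.
\<close>

section \<open>The automorphism group as a group of bijections\<close>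

lemma automorphism_bij: "h \<in> automorphisms M \<Longrightarrow> bij h"
  by (simp add: automorphisms_def isomorphism_between_def)

lemma automorphism_rel:
  "\<lbrakk>h \<in> automorphisms M; r \<in> rels M; length xs = rel_arity M r\<rbrakk> \<Longrightarrow>
    rel_interp M r (map h xs) = rel_interp M r xs"
  by (simp add: automorphisms_def isomorphism_between_def)

lemma automorphism_fun:
  "\<lbrakk>h \<in> automorphisms M; s \<in> funs M; length xs = fun_arity M s\<rbrakk> \<Longrightarrow>
    h (fun_interp M s xs) = fun_interp M s (map h xs)"
  by (simp add: automorphisms_def isomorphism_between_def)

lemma automorphism_id: "id \<in> automorphisms M"
  by (simp add: automorphisms_def isomorphism_between_def)

lemma automorphism_comp:
  assumes "h \<in> automorphisms M" "k \<in> automorphisms M"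
  shows "h \<circ> k \<in> automorphisms M"
proof -
  have "rel_interp M r (map (\<lambda>x. h (k x)) xs) = rel_interp M r xs"
    if "r \<in> rels M" "length xs = rel_arity M r" for r xs
  proof -
    have "rel_interp M r (map h (map k xs)) = rel_interp M r (map k xs)"
      using assms(1) that by (simp add: automorphisms_def isomorphism_between_def del: map_map)
    then show ?thesis
      using assms(2) that by (simp add: automorphisms_def isomorphism_between_def comp_def)
  qed
  moreover have "h (k (fun_interp M f xs)) = fun_interp M f (map (\<lambda>x. h (k x)) xs)"
    if "f \<in> funs M" "length xs = fun_arity M f" for f xs
  proof -
    have "h (fun_interp M f (map k xs)) = fun_interp M f (map h (map k xs))"
      using assms(1) that by (simp add: automorphisms_def isomorphism_between_def del: map_map)
    then show ?thesis
      using assms(2) that by (simp add: automorphisms_def isomorphism_between_def comp_def)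
  qed
  ultimately show ?thesis
    using assms bij_comp[of k h] by (simp add: automorphisms_def isomorphism_between_def comp_def)
qed

lemma automorphism_inv:
  assumes "h \<in> automorphisms M"
  shows "inv_into UNIV h \<in> automorphisms M"
proof -
  have b: "bij h" by (rule automorphism_bij[OF assms])
  then have s: "surj h" and i: "inj h" by (auto simp: bij_def)
  have m: "map h (map (inv_into UNIV h) xs) = xs" for xs
    using s by (simp add: comp_def surj_f_inv_f)
  have "rel_interp M r (map (inv_into UNIV h) xs) = rel_interp M r xs"
    if "r \<in> rels M" "length xs = rel_arity M r" for r xs
  proof -
    have "rel_interp M r (map h (map (inv_into UNIV h) xs)) = rel_interp M r (map (inv_into UNIV h) xs)"
      using assms that by (simp add: automorphisms_def isomorphism_between_def del: map_map)
    then show ?thesis unfolding m by simp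
  qed
  moreover have "inv_into UNIV h (fun_interp M f xs) = fun_interp M f (map (inv_into UNIV h) xs)"
    if "f \<in> funs M" "length xs = fun_arity M f" for f xs
  proof -
    have "h (fun_interp M f (map (inv_into UNIV h) xs)) = fun_interp M f (map h (map (inv_into UNIV h) xs))"
      using assms that by (simp add: automorphisms_def isomorphism_between_def del: map_map)
    then show ?thesis unfolding m using i by (metis inv_f_f)
  qed
  ultimately show ?thesis
    using bij_imp_bij_inv[OF b] by (simp add: automorphisms_def isomorphism_between_def)
qed

text \<open>Each clause in the definition of an automorphism looks at finitely many points, so \<open>Aut(M)\<close> is
  closed among the bijections of \<open>M\<close>.\<close>

lemma automorphism_limit:
  assumes f: "bij f"
    and loc: "\<And>F. finite F \<Longrightarrow> \<exists>h\<in>automorphisms M. \<forall>x\<in>F. h x = f x"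
  shows "f \<in> automorphisms M"
proof -
  have "rel_interp M r (map f xs) = rel_interp M r xs"
    if "r \<in> rels M" "length xs = rel_arity M r" for r xs
  proof -
    obtain h where h: "h \<in> automorphisms M" "\<forall>x\<in>set xs. h x = f x"
      using loc[of "set xs"] by auto
    then have "map f xs = map h xs" by simp
    then show ?thesis
      using automorphism_rel[OF h(1) that] by metis
  qed
  moreover have "f (fun_interp M s xs) = fun_interp M s (map f xs)"
    if "s \<in> funs M" "length xs = fun_arity M s" for s xs
  proof -
    obtain h where h: "h \<in> automorphisms M" "\<forall>x\<in>insert (fun_interp M s xs) (set xs). h x = f x"
      using loc[of "insert (fun_interp M s xs) (set xs)"] by auto
    then have "map f xs = map h xs" "f (fun_interp M s xs) = h (fun_interp M s xs)" by simp_all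
    then show ?thesis
      using automorphism_fun[OF h(1) that] by metis
  qed
  ultimately show ?thesis
    using f by (simp add: automorphisms_def isomorphism_between_def)
qed

lemma aut_group_simps [simp]:
  "carrier (aut_group M) = automorphisms M" "monoid.mult (aut_group M) = (\<circ>)" "monoid.one (aut_group M) = id"
  by (simp_all add: aut_group_def)

lemma group_aut_group: "group (aut_group M)"
proof (rule groupI)
  fix h assume h: "h \<in> carrier (aut_group M)"
  then have "inv_into UNIV h \<circ> h = id"
    using automorphism_bij[of h M] by (auto simp: bij_def)
  then show "\<exists>k\<in>carrier (aut_group M). k \<otimes>\<^bsub>aut_group M\<^esub> h = \<one>\<^bsub>aut_group M\<^esub>"
    using h automorphism_inv[of h M] by auto
qed (auto simp: automorphism_comp automorphism_id comp_assoc)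

lemma inv_aut_group:
  assumes "h \<in> automorphisms M"
  shows "inv\<^bsub>aut_group M\<^esub> h = inv_into UNIV h"
proof (rule group.inv_equality[OF group_aut_group])
  show "inv_into UNIV h \<otimes>\<^bsub>aut_group M\<^esub> h = \<one>\<^bsub>aut_group M\<^esub>"
    using automorphism_bij[OF assms] by (auto simp: bij_def)
qed (use assms automorphism_inv in auto)

lemma automorphism_int_pow:
  "g \<in> automorphisms M \<Longrightarrow> g [^]\<^bsub>aut_group M\<^esub> (l :: int) \<in> automorphisms M"
  using group.int_pow_closed[OF group_aut_group, of g M l] by simp

lemma aut_int_pow_add:
  assumes "g \<in> automorphisms M"
  shows "(g [^]\<^bsub>aut_group M\<^esub> (i :: int)) ((g [^]\<^bsub>aut_group M\<^esub> j) x) = (g [^]\<^bsub>aut_group M\<^esub> (i + j)) x"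
  using group.int_pow_mult[OF group_aut_group, of g M i j] assms by simp

lemma aut_int_pow_1: "g \<in> automorphisms M \<Longrightarrow> g [^]\<^bsub>aut_group M\<^esub> (1 :: int) = g"
  using group.int_pow_1[OF group_aut_group, of g M] by simp

lemma aut_int_pow_minus_1: "g \<in> automorphisms M \<Longrightarrow> g [^]\<^bsub>aut_group M\<^esub> (- 1 :: int) = inv_into UNIV g"
  using group.int_pow_neg[OF group_aut_group, of g M 1]
  by (simp add: aut_int_pow_1 inv_aut_group)

lemma aut_int_pow_cancel [simp]:
  assumes "g \<in> automorphisms M"
  shows "(g [^]\<^bsub>aut_group M\<^esub> (l :: int)) ((g [^]\<^bsub>aut_group M\<^esub> (- l)) x) = x"
    "(g [^]\<^bsub>aut_group M\<^esub> (- l)) ((g [^]\<^bsub>aut_group M\<^esub> l) x) = x"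
  using aut_int_pow_add[OF assms, of l "- l" x] aut_int_pow_add[OF assms, of "- l" l x] by simp_all

lemma no_cycles_int_pow:
  assumes g: "g \<in> automorphisms M" and nc: "no_cycles g"
    and fix_pt: "(g [^]\<^bsub>aut_group M\<^esub> (i :: int)) x = x"
  shows "i = 0"
proof (rule ccontr)
  assume "i \<noteq> 0"
  have pow: "g [^]\<^bsub>aut_group M\<^esub> (int n) = g ^^ n" for n
  proof (induction n)
    case (Suc n)
    have "g [^]\<^bsub>aut_group M\<^esub> (int (Suc n)) = (g [^]\<^bsub>aut_group M\<^esub> (int n)) \<circ> g"
      by (simp add: int_pow_int del: of_nat_Suc)
    then show ?case by (simp add: Suc.IH funpow_Suc_right del: funpow.simps)
  qed simp
  have "(g [^]\<^bsub>aut_group M\<^esub> (- i)) x = x"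
    using aut_int_pow_cancel(2)[OF g, of i x] fix_pt by simp
  with fix_pt have "(g [^]\<^bsub>aut_group M\<^esub> \<bar>i\<bar>) x = x"
    by (cases "i \<ge> 0") auto
  then have "(g ^^ nat \<bar>i\<bar>) x = x"
    using pow[of "nat \<bar>i\<bar>"] by simp
  moreover have "nat \<bar>i\<bar> \<ge> 1" using \<open>i \<noteq> 0\<close> by simp
  ultimately show False using nc unfolding no_cycles_def by blast
qed

lemma openin_aut_topology_iff:
  "openin (aut_topology M) U \<longleftrightarrow> U \<subseteq> automorphisms M \<and>
     (\<forall>h\<in>U. \<exists>F. finite F \<and> (\<forall>k\<in>automorphisms M. (\<forall>x\<in>F. k x = h x) \<longrightarrow> k \<in> U))"
  (is "_ \<longleftrightarrow> ?R U")
proof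
  assume "openin (aut_topology M) U"
  then obtain T where T: "openin (product_topology (\<lambda>_. discrete_topology UNIV) UNIV) T"
      and U: "U = T \<inter> automorphisms M"
    by (auto simp: aut_topology_def openin_subtopology)
  show "?R U"
  proof (intro conjI ballI)
    fix h assume "h \<in> U"
    then have "h \<in> T" using U by simp
    then obtain X where X: "finite {i \<in> UNIV. X i \<noteq> topspace (discrete_topology (UNIV :: 'a set))}"
        "h \<in> Pi\<^sub>E UNIV X" "Pi\<^sub>E UNIV X \<subseteq> T"
      using T unfolding openin_product_topology_alt by blast
    have "k \<in> U" if k: "k \<in> automorphisms M" "\<forall>x\<in>{i. X i \<noteq> UNIV}. k x = h x" for k
    proof -
      have "k i \<in> X i" for i
        using k(2) X(2) by (cases "X i = UNIV") (auto simp: PiE_iff)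
      then show ?thesis using X(3) k(1) U by auto
    qed
    then show "\<exists>F. finite F \<and> (\<forall>k\<in>automorphisms M. (\<forall>x\<in>F. k x = h x) \<longrightarrow> k \<in> U)"
      using X(1) by (intro exI[of _ "{i. X i \<noteq> UNIV}"]) auto
  qed (use U in auto)
next
  assume R: "?R U"
  show "openin (aut_topology M) U"
  proof (subst openin_subopen, intro ballI)
    fix h assume h: "h \<in> U"
    then obtain F where F: "finite F" "\<forall>k\<in>automorphisms M. (\<forall>x\<in>F. k x = h x) \<longrightarrow> k \<in> U"
      using R by blast
    define T where "T = Pi\<^sub>E UNIV (\<lambda>x. if x \<in> F then {h x} else (UNIV :: 'a set))"
    have "{i. (if i \<in> F then {h i} else UNIV) \<noteq> UNIV} \<subseteq> F" by auto
    then have "openin (product_topology (\<lambda>_. discrete_topology UNIV) UNIV) T"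
      unfolding T_def openin_PiE_gen using finite_subset[OF _ F(1)] by auto
    then have "openin (aut_topology M) (T \<inter> automorphisms M)"
      by (auto simp: aut_topology_def openin_subtopology)
    moreover have "h \<in> T \<inter> automorphisms M"
      using h R by (auto simp: T_def)
    moreover have "T \<inter> automorphisms M \<subseteq> U"
    proof
      fix k assume k: "k \<in> T \<inter> automorphisms M"
      then have "k x = h x" if "x \<in> F" for x
        using that by (auto simp: T_def PiE_iff split: if_splits dest: spec[of _ x])
      then show "k \<in> U" using F(2) k by blast
    qed
    ultimately show "\<exists>T. openin (aut_topology M) T \<and> h \<in> T \<and> T \<subseteq> U" by blast
  qed
qed

section \<open>Words under homomorphisms\<close>

lemma word_value_simps [simp]:
  "word_value H a b [] = \<one>\<^bsub>H\<^esub>"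
  "word_value H a b (s # w) = letter_value H a b s \<otimes>\<^bsub>H\<^esub> word_value H a b w"
  by (simp_all add: word_value_def)

lemma letter_value_closed:
  assumes "group H" "a \<in> carrier H" "b \<in> carrier H"
  shows "letter_value H a b s \<in> carrier H"
  using assms group.inv_closed by (cases s) (auto simp: letter_value_def Let_def)

lemma word_value_closed:
  assumes "group H" "a \<in> carrier H" "b \<in> carrier H"
  shows "word_value H a b w \<in> carrier H"
proof -
  interpret group H by fact
  show ?thesis
    by (induction w) (use letter_value_closed[OF assms] in auto)
qed

lemma word_value_hom:
  assumes "group H" "group K" "f \<in> hom H K" "a \<in> carrier H" "b \<in> carrier H"
  shows "f (word_value H a b w) = word_value K (f a) (f b) w"
proof -
  interpret group_hom H K f
    using assms by (simp add: group_hom_def group_hom_axioms_def)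
  show ?thesis
  proof (induction w)
    case (Cons s w)
    have "f (letter_value H a b s) = letter_value K (f a) (f b) s"
      using assms by (cases s) (auto simp: letter_value_def Let_def)
    then show ?case
      using Cons.IH letter_value_closed[OF assms(1,4,5)] word_value_closed[OF assms(1,4,5)] by simp
  qed simp
qed

section \<open>Evading a given word\<close>

text \<open>An automorphism committed on \<open>A\<close> can still send any further point out of a given finite set:
  compose it with the elements of the stabilizer of \<open>h ` A\<close>, under which \<open>h x\<close> has an infinite orbit.\<close>

lemma no_algebraicity_move:
  assumes na: "no_algebraicity M" and h: "h \<in> automorphisms M"
    and fin: "finite A" "finite Z" and x: "x \<notin> A"
  obtains h' where "h' \<in> automorphisms M" "\<forall>a\<in>A. h' a = h a" "h' x \<notin> Z"
proof -
  have "h x \<notin> h ` A"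
    using x automorphism_bij[OF h] by (auto simp: bij_def inj_def)
  then have inf: "infinite {k ` {h x} | k. k \<in> pointwise_stabilizer M (h ` A)}"
    using na[unfolded no_algebraicity_def, rule_format, of "h ` A" "{h x}"] fin(1) by simp
  have "\<exists>k\<in>pointwise_stabilizer M (h ` A). k (h x) \<notin> Z"
  proof (rule ccontr)
    assume "\<not> ?thesis"
    then have "{k ` {h x} | k. k \<in> pointwise_stabilizer M (h ` A)} \<subseteq> (\<lambda>z. {z}) ` Z"
      by auto
    then show False using inf fin(2) finite_surj by blast
  qed
  then obtain k where k: "k \<in> automorphisms M" "\<forall>y\<in>h ` A. k y = y" "k (h x) \<notin> Z"
    by (auto simp: pointwise_stabilizer_def)
  show thesis
    using that[of "k \<circ> h"] k automorphism_comp[OF k(1) h] by simp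
qed

lemma no_algebraicity_move_inv:
  assumes na: "no_algebraicity M" and h: "h \<in> automorphisms M"
    and fin: "finite A" "finite Z" and x: "x \<notin> h ` A"
  obtains h' y where "h' \<in> automorphisms M" "\<forall>a\<in>A. h' a = h a" "h' y = x" "y \<notin> Z"
proof -
  obtain k where k: "k \<in> automorphisms M" "\<forall>b\<in>h ` A. k b = inv_into UNIV h b" "k x \<notin> Z"
    using no_algebraicity_move[OF na automorphism_inv[OF h] finite_imageI[OF fin(1)] fin(2) x] .
  have kb: "bij k" and hb: "bij h" using automorphism_bij k(1) h by blast+
  have "inv_into UNIV k a = h a" if "a \<in> A" for a
  proof -
    have "k (h a) = a" using k(2) that hb by (simp add: bij_is_inj)
    then show ?thesis using kb by (metis bij_inv_eq_iff)
  qed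
  moreover have "inv_into UNIV k (k x) = x" using kb by (simp add: bij_is_inj)
  ultimately show thesis
    using that[of "inv_into UNIV k" "k x"] automorphism_inv[OF k(1)] k(3) by blast
qed

text \<open>The invariant of the construction of an \<open>h\<close> that violates a word. The path of a point \<open>x\<close> under a
  word \<open>w\<close> in \<open>g\<close> and \<open>h\<close> is read off from the right, and \<open>h\<close> is committed on the finite set \<open>A\<close>
  only as far as the path requires. The path has reached \<open>g\<^sup>k y\<close>, where \<open>y\<close> is the point at which
  the last \<open>h\<close>-letter arrived (or \<open>x\<close>) and \<open>k\<close> sums the \<open>g\<close>-letters read since; \<open>s\<close> is the sign of
  that \<open>h\<close>-letter. Words of length at most \<open>N\<close> are considered, so that only the points \<open>g\<^sup>i y\<close>
  with \<open>|i| \<le> N\<close> can be reached before the next \<open>h\<close>-letter. These avoid the domain \<open>A\<close> and the range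
  \<open>h ` A\<close> of the commitment, except that \<open>y\<close> itself was just put in one of them; at \<open>y\<close> this blocks
  only the letter cancelling the last one, which a reduced word does not use.\<close>

definition free_path ::
    "('f, 'r, 'a) fo_structure \<Rightarrow> ('a \<Rightarrow> 'a) \<Rightarrow> int \<Rightarrow> 'a \<Rightarrow> (bool \<times> bool) list \<Rightarrow>
      ('a \<Rightarrow> 'a) \<Rightarrow> 'a set \<Rightarrow> 'a \<Rightarrow> int \<Rightarrow> bool option \<Rightarrow> bool" where
  "free_path M g N x w h A y k s \<longleftrightarrow>
     h \<in> automorphisms M \<and> finite A \<and> \<bar>k\<bar> \<le> int (length w) \<and>
     (\<forall>h'\<in>automorphisms M. (\<forall>a\<in>A. h' a = h a) \<longrightarrow>
        word_value (aut_group M) g h' w x = (g [^]\<^bsub>aut_group M\<^esub> k) y) \<and>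
     (\<forall>i. \<bar>i\<bar> \<le> N \<longrightarrow>
        ((g [^]\<^bsub>aut_group M\<^esub> i) y \<in> A \<longrightarrow> i = 0 \<and> s = Some False) \<and>
        ((g [^]\<^bsub>aut_group M\<^esub> i) y \<in> h ` A \<longrightarrow> i = 0 \<and> s = Some True) \<and>
        ((g [^]\<^bsub>aut_group M\<^esub> i) y = x \<longrightarrow> i = 0 \<and> s = None)) \<and>
     (case w of [] \<Rightarrow> k = 0 \<and> s = None
        | (u, e) # _ \<Rightarrow> if u then (if e then k > 0 else k < 0) else k = 0 \<and> s = Some e)"

text \<open>A \<open>g\<close>-letter only moves along the orbit of \<open>y\<close>. At an \<open>h\<close>-letter the current point is free for that
  letter, and its image (or preimage) can be chosen so fresh that the next stretch of its \<open>g\<close>-orbit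
  meets no point seen so far; since \<open>g\<close> has no cycles, that stretch does not return to the new point
  either.\<close>

lemma ex_free_path:
  fixes M :: "('f, 'r, 'a) fo_structure"
  assumes na: "no_algebraicity M" and g: "g \<in> automorphisms M" and nc: "no_cycles g"
    and w: "reduced_word w" "int (length w) \<le> N"
  shows "\<exists>h A y k s. free_path M g N x w h A y k s"
  using w
proof (induction w)
  case Nil
  have "free_path M g N x [] id {} x 0 None"
    using no_cycles_int_pow[OF g nc, of _ x] by (auto simp: free_path_def automorphism_id)
  then show ?case by blast
next
  case (Cons l w)
  obtain u e where l: "l = (u, e)" by fastforce
  have red: "reduced_word w" "w \<noteq> [] \<Longrightarrow> fst (hd w) = u \<Longrightarrow> snd (hd w) = e"
    using Cons.prems(1) by (cases w; auto simp: reduced_word_def l)+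
  then obtain h A y k s where p: "free_path M g N x w h A y k s"
    using Cons by auto
  define \<gamma> where "\<gamma> = (\<lambda>i :: int. g [^]\<^bsub>aut_group M\<^esub> i)"
  have \<gamma>: "\<gamma> i (\<gamma> j z) = \<gamma> (i + j) z" "\<gamma> 0 z = z" "\<gamma> 1 = g" "\<gamma> (- 1) = inv_into UNIV g" for i j z
    using aut_int_pow_add[OF g] aut_int_pow_1[OF g] aut_int_pow_minus_1[OF g]
    by (simp_all add: \<gamma>_def)
  have pre: "h \<in> automorphisms M" "finite A" "\<bar>k\<bar> \<le> int (length w)"
    and path: "\<And>h'. h' \<in> automorphisms M \<Longrightarrow> \<forall>a\<in>A. h' a = h a \<Longrightarrow>
        word_value (aut_group M) g h' w x = \<gamma> k y"
    and fresh: "\<And>i. \<bar>i\<bar> \<le> N \<Longrightarrow> \<gamma> i y \<in> A \<Longrightarrow> i = 0 \<and> s = Some False"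
        "\<And>i. \<bar>i\<bar> \<le> N \<Longrightarrow> \<gamma> i y \<in> h ` A \<Longrightarrow> i = 0 \<and> s = Some True"
        "\<And>i. \<bar>i\<bar> \<le> N \<Longrightarrow> \<gamma> i y = x \<Longrightarrow> i = 0 \<and> s = None"
    and shape: "case w of [] \<Rightarrow> k = 0 \<and> s = None
        | (u, e) # _ \<Rightarrow> if u then (if e then k > 0 else k < 0) else k = 0 \<and> s = Some e"
    using p by (auto simp: free_path_def \<gamma>_def)
  have kN: "\<bar>k\<bar> \<le> N" using pre(3) Cons.prems(2) by simp
  have cyc: "i = 0" if "\<gamma> i z = z" for i z
    using no_cycles_int_pow[OF g nc] that by (simp add: \<gamma>_def)
  show ?case
  proof (cases u)
    case True
    define k' where "k' = (if e then 1 + k else -1 + k)"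
    have letter: "letter_value (aut_group M) g h' l z = \<gamma> (if e then 1 else -1) z" for h' z
      using True \<gamma> by (simp add: letter_value_def l inv_aut_group[OF g])
    have "word_value (aut_group M) g h' (l # w) x = \<gamma> k' y"
      if "h' \<in> automorphisms M" "\<forall>a\<in>A. h' a = h a" for h'
      using path[OF that] letter \<gamma>(1) by (simp add: k'_def)
    moreover have "\<bar>k'\<bar> \<le> int (length (l # w))"
      using pre(3) by (auto simp: k'_def)
    moreover have "if e then k' > 0 else k' < 0"
      using shape red(2) True by (cases w) (auto simp: k'_def split: if_splits)
    ultimately have "free_path M g N x (l # w) h A y k' s"
      using pre fresh True unfolding free_path_def \<gamma>_def[symmetric] by (auto simp: l)
    then show ?thesis by blast
  next
    case False
    define z where "z = \<gamma> k y"
    (* A point outside Z stays away from all points seen so far under the powers of g up to N. *)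
    define Z where "Z = (\<lambda>(i, c). \<gamma> (- i) c) ` ({- N..N} \<times> (A \<union> h ` A \<union> {z, x}))"
    have "finite Z" using pre(2) by (simp add: Z_def)
    have Z: "\<gamma> i c \<notin> A \<union> h ` A \<union> {z, x}" if "c \<notin> Z" "\<bar>i\<bar> \<le> N" for i c
    proof
      assume "\<gamma> i c \<in> A \<union> h ` A \<union> {z, x}"
      then have "\<gamma> (- i) (\<gamma> i c) \<in> Z"
        using that(2) unfolding Z_def by (intro image_eqI[of _ _ "(i, \<gamma> i c)"]) auto
      then show False using that(1) by (simp add: \<gamma>)
    qed
    have s: "s \<noteq> Some (\<not> e)" if "k = 0"
      using shape red(2) False that by (cases w) (auto split: if_splits)
    show ?thesis
    proof (cases e)
      case True
      have "z \<notin> A" using fresh(1)[OF kN] s True by (auto simp: z_def)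
      then obtain h' where h': "h' \<in> automorphisms M" "\<forall>a\<in>A. h' a = h a" "h' z \<notin> Z"
        using no_algebraicity_move[OF na pre(1,2) \<open>finite Z\<close>] by metis
      have "word_value (aut_group M) g h'' (l # w) x = h' z"
        if "h'' \<in> automorphisms M" "\<forall>a\<in>insert z A. h'' a = h' a" for h''
        using path[OF that(1)] that h'(2) True False by (simp add: l letter_value_def z_def)
      moreover have "i = 0" if "\<gamma> i (h' z) = h' z" for i using cyc that by blast
      moreover have "h' ` A = h ` A" using h'(2) by (auto simp: image_iff)
      ultimately have "free_path M g N x (l # w) h' (insert z A) (h' z) 0 (Some True)"
        using h' pre(2) Z[OF h'(3)] True False
        unfolding free_path_def \<gamma>_def[symmetric] by (auto simp: l \<gamma>)
      then show ?thesis by blast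
    next
      case e: False
      have "z \<notin> h ` A" using fresh(2)[OF kN] s e by (auto simp: z_def)
      then obtain h' c where h': "h' \<in> automorphisms M" "\<forall>a\<in>A. h' a = h a" "h' c = z" "c \<notin> Z"
        using no_algebraicity_move_inv[OF na pre(1,2) \<open>finite Z\<close>] by metis
      have "word_value (aut_group M) g h'' (l # w) x = c"
        if "h'' \<in> automorphisms M" "\<forall>a\<in>insert c A. h'' a = h' a" for h''
      proof -
        have "inv_into UNIV h'' z = c"
          using that h'(3) automorphism_bij[OF that(1)] by (metis bij_inv_eq_iff insertI1)
        then show ?thesis
          using path[OF that(1)] that h'(2) e False
          by (simp add: l letter_value_def z_def inv_aut_group)
      qed
      moreover have "i = 0" if "\<gamma> i c = c" for i using cyc that by blast
      moreover have "h' ` A = h ` A" using h'(2) by (auto simp: image_iff)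
      ultimately have "free_path M g N x (l # w) h' (insert c A) c 0 (Some False)"
        using h' pre(2) Z[OF h'(4)] e False
        unfolding free_path_def \<gamma>_def[symmetric] by (auto simp: l \<gamma>)
      then show ?thesis by blast
    qed
  qed
qed

text \<open>The path of a nonempty reduced word does not end where it began: it either ends on a fresh stretch, or
  the word is a nontrivial power of \<open>g\<close>, which has no cycles.\<close>

lemma ex_word_moves_point:
  assumes "no_algebraicity M" "g \<in> automorphisms M" "no_cycles g"
    and w: "reduced_word w" "w \<noteq> []"
  obtains h A x where "h \<in> automorphisms M" "finite A"
    "\<forall>h'\<in>automorphisms M. (\<forall>a\<in>A. h' a = h a) \<longrightarrow> word_value (aut_group M) g h' w x \<noteq> x"
proof -
  fix x
  obtain h A y k s where p: "free_path M g (int (length w)) x w h A y k s"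
    using ex_free_path[OF assms(1-4)] by blast
  have "(g [^]\<^bsub>aut_group M\<^esub> k) y \<noteq> x"
  proof
    assume "(g [^]\<^bsub>aut_group M\<^esub> k) y = x"
    then have "k = 0" "s = None" using p by (auto simp: free_path_def)
    then show False using p w(2) by (cases w) (auto simp: free_path_def split: if_splits)
  qed
  then show thesis using that[of h A x] p by (auto simp: free_path_def)
qed

section \<open>A point with dense conjugacy orbit\<close>

definition conjugates_amalgamate :: "('f, 'r, 'a) fo_structure \<Rightarrow> ('a \<Rightarrow> 'a) \<Rightarrow> bool" where
  "conjugates_amalgamate M g \<longleftrightarrow>
     (\<forall>n\<ge>1. \<forall>\<phi> \<psi> :: nat \<Rightarrow> ('a \<times> 'a) set.
        (\<forall>i\<in>{1..n}. partial_automorphism M (\<phi> i)) \<longrightarrow>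
        (\<forall>i\<in>{1..n}. partial_automorphism M (\<psi> i)) \<longrightarrow>
        (\<exists>k m :: int. \<forall>i\<in>{1..n}. \<exists>h\<in>automorphisms M.
           extends_graph h (conj_partial M g k (\<phi> i) \<union> conj_partial M g m (\<psi> i))))"

definition aut_conj :: "('f, 'r, 'a) fo_structure \<Rightarrow> ('a \<Rightarrow> 'a) \<Rightarrow> int \<Rightarrow> ('a \<Rightarrow> 'a) \<Rightarrow> 'a \<Rightarrow> 'a" where
  "aut_conj M g l h = g [^]\<^bsub>aut_group M\<^esub> l \<circ> h \<circ> g [^]\<^bsub>aut_group M\<^esub> (- l)"

lemma aut_conj_closed:
  "g \<in> automorphisms M \<Longrightarrow> h \<in> automorphisms M \<Longrightarrow> aut_conj M g l h \<in> automorphisms M"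
  by (simp add: aut_conj_def automorphism_comp automorphism_int_pow)

lemma aut_conj_add:
  "g \<in> automorphisms M \<Longrightarrow> aut_conj M g i (aut_conj M g j h) = aut_conj M g (i + j) h"
  by (simp add: aut_conj_def fun_eq_iff aut_int_pow_add algebra_simps)

lemma extends_conj_partial_iff:
  assumes "g \<in> automorphisms M"
  shows "extends_graph h (conj_partial M g k p) \<longleftrightarrow> extends_graph (aut_conj M g (- k) h) p"
proof -
  have "h ((g [^]\<^bsub>aut_group M\<^esub> k) x) = (g [^]\<^bsub>aut_group M\<^esub> k) y \<longleftrightarrow>
      (g [^]\<^bsub>aut_group M\<^esub> (- k)) (h ((g [^]\<^bsub>aut_group M\<^esub> k) x)) = y" for x y
    using aut_int_pow_cancel[OF assms, of k] by metis
  then show ?thesis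
    by (simp add: extends_graph_def conj_partial_def aut_conj_def case_prod_beta)
qed

text \<open>Conjugating by a power of \<open>g\<close> turns the two exponents of the amalgamation hypothesis into one:
  conjugation by \<open>g\<close> acts topologically transitively on every finite power of \<open>Aut(M)\<close>.\<close>

lemma conjugation_transitive:
  assumes am: "conjugates_amalgamate M g" and g: "g \<in> automorphisms M" and I: "finite I"
    and \<phi>: "\<And>i. i \<in> I \<Longrightarrow> partial_automorphism M (\<phi> i)"
    and \<psi>: "\<And>i. i \<in> I \<Longrightarrow> partial_automorphism M (\<psi> i)"
  shows "\<exists>l. \<forall>i\<in>I. \<exists>h\<in>automorphisms M. extends_graph h (\<phi> i) \<and> extends_graph (aut_conj M g l h) (\<psi> i)"
proof (cases "I = {}")
  case False
  obtain e where e: "bij_betw e {1..card I} I"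
    using ex_bij_betw_nat_finite_1[OF I] by blast
  then have eI: "e ` {1..card I} = I" by (simp add: bij_betw_def)
  have "card I \<ge> 1" using I False by (simp add: Suc_le_eq card_gt_0_iff)
  moreover have "partial_automorphism M ((\<phi> \<circ> e) i)" "partial_automorphism M ((\<psi> \<circ> e) i)"
    if "i \<in> {1..card I}" for i
    using \<phi> \<psi> bij_betwE[OF e] that by auto
  ultimately obtain k m where km: "\<forall>i\<in>{1..card I}. \<exists>h\<in>automorphisms M.
      extends_graph h (conj_partial M g k ((\<phi> \<circ> e) i) \<union> conj_partial M g m ((\<psi> \<circ> e) i))"
    using am[unfolded conjugates_amalgamate_def, rule_format, of "card I" "\<phi> \<circ> e" "\<psi> \<circ> e"] by blast
  have "\<exists>h\<in>automorphisms M. extends_graph h (\<phi> i) \<and> extends_graph (aut_conj M g (k - m) h) (\<psi> i)"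
    if i: "i \<in> I" for i
  proof -
    obtain j where "j \<in> {1..card I}" "i = e j" using i eI by blast
    then obtain h where h: "h \<in> automorphisms M"
        "extends_graph h (conj_partial M g k (\<phi> i) \<union> conj_partial M g m (\<psi> i))"
      using bspec[OF km, of j] by auto
    then have "extends_graph h (conj_partial M g k (\<phi> i))" "extends_graph h (conj_partial M g m (\<psi> i))"
      by (simp_all add: extends_graph_def ball_Un)
    then have "extends_graph (aut_conj M g (- k) h) (\<phi> i)" "extends_graph (aut_conj M g (- m) h) (\<psi> i)"
      by (simp_all add: extends_conj_partial_iff[OF g])
    moreover have "aut_conj M g (- m) h = aut_conj M g (k - m) (aut_conj M g (- k) h)"
      by (simp add: aut_conj_add[OF g])
    ultimately show ?thesis
      using aut_conj_closed[OF g h(1)] by metis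
  qed
  then show ?thesis by blast
qed simp

text \<open>Transitivity is applied to the finitely many cells of \<open>c\<close>, one representative for each. Adding \<open>z\<close> to
  domain and range is the back-and-forth part, which makes the union of all stages a bijection.\<close>

lemma extension_step:
  fixes \<Phi> \<Psi> :: "'x \<Rightarrow> ('a \<times> 'a) set"
  assumes am: "conjugates_amalgamate M g" and g: "g \<in> automorphisms M" and fin: "finite (c ` X)"
    and \<Phi>: "\<And>x. x \<in> X \<Longrightarrow> partial_automorphism M (\<Phi> x)"
      "\<And>x y. x \<in> X \<Longrightarrow> y \<in> X \<Longrightarrow> c x = c y \<Longrightarrow> \<Phi> x = \<Phi> y"
    and \<Psi>: "\<And>x. x \<in> X \<Longrightarrow> partial_automorphism M (\<Psi> x)"
      "\<And>x y. x \<in> X \<Longrightarrow> y \<in> X \<Longrightarrow> c x = c y \<Longrightarrow> \<Psi> x = \<Psi> y"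
  obtains \<Phi>' l where "\<forall>x\<in>X. partial_automorphism M (\<Phi>' x)"
    and "\<forall>x\<in>X. \<Phi> x \<subseteq> \<Phi>' x \<and> z \<in> Domain (\<Phi>' x) \<and> z \<in> Range (\<Phi>' x)"
    and "\<forall>x\<in>X. \<forall>y\<in>X. c x = c y \<longrightarrow> \<Phi>' x = \<Phi>' y"
    and "\<forall>x\<in>X. \<forall>h. extends_graph h (\<Phi>' x) \<longrightarrow> extends_graph (aut_conj M g l h) (\<Psi> x)"
proof -
  define r where "r = inv_into X c"
  have r: "r (c x) \<in> X" "\<Phi> (r (c x)) = \<Phi> x" "\<Psi> (r (c x)) = \<Psi> x" if "x \<in> X" for x
  proof -
    have *: "r (c x) \<in> X" "c (r (c x)) = c x"
      using that by (auto simp: r_def inv_into_into f_inv_into_f)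
    then show "r (c x) \<in> X" "\<Phi> (r (c x)) = \<Phi> x" "\<Psi> (r (c x)) = \<Psi> x"
      using \<Phi>(2) \<Psi>(2) that by blast+
  qed
  obtain l where "\<forall>i\<in>c ` X. \<exists>h\<in>automorphisms M.
      extends_graph h (\<Phi> (r i)) \<and> extends_graph (aut_conj M g l h) (\<Psi> (r i))"
    using conjugation_transitive[OF am g fin, of "\<lambda>i. \<Phi> (r i)" "\<lambda>i. \<Psi> (r i)"] r(1) \<Phi>(1) \<Psi>(1) by blast
  then obtain H where H: "\<And>i. i \<in> c ` X \<Longrightarrow> H i \<in> automorphisms M \<and>
      extends_graph (H i) (\<Phi> (r i)) \<and> extends_graph (aut_conj M g l (H i)) (\<Psi> (r i))"
    by metis
  define k where "k x = H (c x)" for x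
  have k: "k x \<in> automorphisms M" "extends_graph (k x) (\<Phi> x)" "extends_graph (aut_conj M g l (k x)) (\<Psi> x)"
    if "x \<in> X" for x
    using H[of "c x"] r[OF that] that by (auto simp: k_def)
  define D where "D x = fst ` \<Phi> x \<union> {z, inv_into UNIV (k x) z} \<union>
      (g [^]\<^bsub>aut_group M\<^esub> (- l)) ` fst ` \<Psi> x" for x
  define \<Phi>' where "\<Phi>' x = (\<lambda>a. (a, k x a)) ` D x" for x
  have "partial_automorphism M (\<Phi>' x) \<and> \<Phi> x \<subseteq> \<Phi>' x \<and> z \<in> Domain (\<Phi>' x) \<and> z \<in> Range (\<Phi>' x)"
    if x: "x \<in> X" for x
  proof (intro conjI)
    have "finite (D x)"
      using \<Phi>(1)[OF x] \<Psi>(1)[OF x] by (simp add: D_def partial_automorphism_def)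
    then show "partial_automorphism M (\<Phi>' x)"
      using k(1)[OF x] by (auto simp: partial_automorphism_def extends_graph_def \<Phi>'_def)
    show "\<Phi> x \<subseteq> \<Phi>' x"
      using k(2)[OF x] by (force simp: extends_graph_def \<Phi>'_def D_def)
    show "z \<in> Domain (\<Phi>' x)"
      by (force simp: \<Phi>'_def D_def)
    have "k x (inv_into UNIV (k x) z) = z"
      using automorphism_bij[OF k(1)[OF x]] by (simp add: bij_is_surj surj_f_inv_f)
    then show "z \<in> Range (\<Phi>' x)"
      by (force simp: \<Phi>'_def D_def)
  qed
  moreover have "\<Phi>' x = \<Phi>' y" if "x \<in> X" "y \<in> X" "c x = c y" for x y
    using \<Phi>(2)[OF that] \<Psi>(2)[OF that] that(3) by (simp add: \<Phi>'_def D_def k_def)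
  moreover have "extends_graph (aut_conj M g l h) (\<Psi> x)" if "x \<in> X" "extends_graph h (\<Phi>' x)" for x h
  proof -
    have "h a = k x a" if "a \<in> D x" for a
      using \<open>extends_graph h (\<Phi>' x)\<close> that by (auto simp: extends_graph_def \<Phi>'_def)
    then have "aut_conj M g l h (fst q) = aut_conj M g l (k x) (fst q)" if "q \<in> \<Psi> x" for q
      using that by (simp add: aut_conj_def D_def)
    then show ?thesis
      using k(3)[OF \<open>x \<in> X\<close>] by (simp add: extends_graph_def case_prod_beta)
  qed
  ultimately show thesis
    by (intro that[of \<Phi>' l]) blast+
qed

lemma partial_automorphism_chain_limit:
  assumes p: "\<And>n :: nat. partial_automorphism M (p n)" and mono: "\<And>n. p n \<subseteq> p (Suc n)"
    and dom: "\<And>a. \<exists>n. a \<in> Domain (p n)" and ran: "\<And>a. \<exists>n. a \<in> Range (p n)"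
  shows "\<exists>f\<in>automorphisms M. \<forall>n. extends_graph f (p n)"
proof -
  have le: "p m \<subseteq> p n" if "m \<le> n" for m n
    using lift_Suc_mono_le[of p] mono that by blast
  have common: "\<exists>h\<in>automorphisms M. h (fst s) = snd s \<and> h (fst t) = snd t"
    if st: "s \<in> (\<Union>n. p n)" "t \<in> (\<Union>n. p n)" for s t
  proof -
    obtain i j where "s \<in> p i" "t \<in> p j" using st by blast
    then have "s \<in> p (max i j)" "t \<in> p (max i j)" using le[of i "max i j"] le[of j "max i j"] by auto
    then show ?thesis
      using p[of "max i j"] unfolding partial_automorphism_def extends_graph_def by fastforce
  qed
  have "\<forall>a. \<exists>y. (a, y) \<in> (\<Union>n. p n)" using dom by blast
  then obtain f where f: "\<And>a. (a, f a) \<in> (\<Union>n. p n)" by metis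
  have ext: "f a = y" if "(a, y) \<in> (\<Union>n. p n)" for a y
    using common[OF that f[of a]] by auto
  have "inj f"
  proof
    fix a b assume "f a = f b"
    then show "a = b"
      using common[OF f[of a] f[of b]] automorphism_bij[of _ M] by (auto simp: bij_def inj_def)
  qed
  moreover have "surj f"
    using ran ext by (metis RangeE UNIV_I UN_I surjI surj_def)
  moreover have "\<exists>h\<in>automorphisms M. \<forall>x\<in>F. h x = f x" if "finite F" for F
  proof -
    have "\<exists>n. \<forall>x\<in>F. (x, f x) \<in> p n"
      using that
    proof (induction F)
      case (insert x F)
      then obtain n m where "\<forall>x\<in>F. (x, f x) \<in> p n" "(x, f x) \<in> p m" using f[of x] by auto
      then have "\<forall>y\<in>insert x F. (y, f y) \<in> p (max n m)"
        using le[of n "max n m"] le[of m "max n m"] by auto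
      then show ?case by blast
    qed simp
    then show ?thesis using p by (fastforce simp: partial_automorphism_def extends_graph_def)
  qed
  ultimately have "f \<in> automorphisms M"
    by (intro automorphism_limit) (auto simp: bij_def)
  then show ?thesis using ext by (auto simp: extends_graph_def)
qed

text \<open>The third property of \<open>b\<close> makes it continuous for the topology generated by the partitions; this is
  what yields measurability on the unit interval.\<close>

lemma generic_map:
  fixes M :: "('f, 'r, 'a :: countable) fo_structure" and c :: "nat \<Rightarrow> 'x \<Rightarrow> nat"
  assumes am: "conjugates_amalgamate M g" and g: "g \<in> automorphisms M"
    and fin: "\<And>n. finite (c n ` X)"
    and refine: "\<And>n x y. x \<in> X \<Longrightarrow> y \<in> X \<Longrightarrow> c (Suc n) x = c (Suc n) y \<Longrightarrow> c n x = c n y"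
  obtains b where "\<And>x. x \<in> X \<Longrightarrow> b x \<in> automorphisms M"
    and "\<And>N \<phi>. (\<And>i. i \<in> c N ` X \<Longrightarrow> partial_automorphism M (\<phi> i)) \<Longrightarrow>
        \<exists>l. \<forall>x\<in>X. extends_graph (aut_conj M g l (b x)) (\<phi> (c N x))"
    and "\<And>a. \<exists>N. \<forall>x\<in>X. \<forall>y\<in>X. c N x = c N y \<longrightarrow> b x a = b y a"
proof -
  have refine_le: "c m x = c m y" if "m \<le> n" "x \<in> X" "y \<in> X" "c n x = c n y" for m n x y
    using that by (induction n rule: dec_induct) (use refine in blast)+
  define z where "z n = (from_nat n :: 'a)" for n
  (* Stage n serves the target with code snd (prod_decode n); every code recurs at stages so late
     that their partition refines the one on which the target is given. *)
  define target where "target n = (from_nat (snd (prod_decode n)) :: nat \<times> ('a \<times> 'a) list list)" for n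
  define \<Psi> where "\<Psi> n x = (let (N, t) = target n in
      if N \<le> n \<and> partial_automorphism M (set (t ! c N x)) then set (t ! c N x) else {})" for n x
  have empty: "partial_automorphism M {}"
    using automorphism_id by (auto simp: partial_automorphism_def extends_graph_def)
  have \<Psi>: "partial_automorphism M (\<Psi> n x)" for n x
    using empty by (simp add: \<Psi>_def Let_def case_prod_beta)
  have \<Psi>_cell: "\<Psi> n x = \<Psi> n y" if "x \<in> X" "y \<in> X" "c n x = c n y" for n x y
    using refine_le[of "fst (target n)" n x y] that
    by (cases "fst (target n) \<le> n") (simp_all add: \<Psi>_def case_prod_beta)
  define P where "P n \<Phi> \<longleftrightarrow> (\<forall>x\<in>X. partial_automorphism M (\<Phi> x)) \<and>
      (\<forall>x\<in>X. \<forall>y\<in>X. c n x = c n y \<longrightarrow> \<Phi> x = \<Phi> y)" for n and \<Phi> :: "'x \<Rightarrow> ('a \<times> 'a) set"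
  define Q where "Q n \<Phi> \<Phi>' \<longleftrightarrow>
      (\<forall>x\<in>X. \<Phi> x \<subseteq> \<Phi>' x \<and> z n \<in> Domain (\<Phi>' x) \<and> z n \<in> Range (\<Phi>' x)) \<and>
      (\<exists>l. \<forall>x\<in>X. \<forall>h. extends_graph h (\<Phi>' x) \<longrightarrow> extends_graph (aut_conj M g l h) (\<Psi> n x))"
    for n and \<Phi> \<Phi>' :: "'x \<Rightarrow> ('a \<times> 'a) set"
  have "\<exists>\<Phi>. \<forall>n. P n (\<Phi> n) \<and> Q n (\<Phi> n) (\<Phi> (Suc n))"
  proof (rule dependent_nat_choice)
    show "\<exists>\<Phi>. P 0 \<Phi>" by (rule exI[of _ "\<lambda>_. {}"]) (simp add: P_def empty)
  next
    fix \<Phi> n assume "P n \<Phi>"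
    have "partial_automorphism M (\<Phi> x)" if "x \<in> X" for x
      using \<open>P n \<Phi>\<close> that unfolding P_def by blast
    moreover have "\<Phi> x = \<Phi> y" if "x \<in> X" "y \<in> X" "c (Suc n) x = c (Suc n) y" for x y
      using \<open>P n \<Phi>\<close> that(1,2) refine[OF that] unfolding P_def by blast
    moreover have "\<Psi> n x = \<Psi> n y" if "x \<in> X" "y \<in> X" "c (Suc n) x = c (Suc n) y" for x y
      by (rule \<Psi>_cell[OF that(1,2) refine[OF that]])
    ultimately obtain \<Phi>' l where *: "\<forall>x\<in>X. partial_automorphism M (\<Phi>' x)"
      "\<forall>x\<in>X. \<Phi> x \<subseteq> \<Phi>' x \<and> z n \<in> Domain (\<Phi>' x) \<and> z n \<in> Range (\<Phi>' x)"
      "\<forall>x\<in>X. \<forall>y\<in>X. c (Suc n) x = c (Suc n) y \<longrightarrow> \<Phi>' x = \<Phi>' y"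
      "\<forall>x\<in>X. \<forall>h. extends_graph h (\<Phi>' x) \<longrightarrow> extends_graph (aut_conj M g l h) (\<Psi> n x)"
      using extension_step[OF am g fin[of "Suc n"], of \<Phi> "\<Psi> n" "z n" thesis] \<Psi> by blast
    have "P (Suc n) \<Phi>'" unfolding P_def using *(1,3) by blast
    moreover have "Q n \<Phi> \<Phi>'" unfolding Q_def using *(2,4) by blast
    ultimately show "\<exists>\<Phi>'. P (Suc n) \<Phi>' \<and> Q n \<Phi> \<Phi>'" by blast
  qed
  then obtain \<Phi> where \<Phi>P: "\<And>n. P n (\<Phi> n)" and \<Phi>Q: "\<And>n. Q n (\<Phi> n) (\<Phi> (Suc n))" by blast
  have \<Phi>: "partial_automorphism M (\<Phi> n x)" "\<Phi> n x \<subseteq> \<Phi> (Suc n) x" if "x \<in> X" for n x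
    using \<Phi>P[of n] \<Phi>Q[of n] that unfolding P_def Q_def by blast+
  have "\<exists>f\<in>automorphisms M. \<forall>n. extends_graph f (\<Phi> n x)" if x: "x \<in> X" for x
  proof (rule partial_automorphism_chain_limit)
    fix a :: 'a
    have "z (to_nat a) = a" by (simp add: z_def)
    then have "a \<in> Domain (\<Phi> (Suc (to_nat a)) x)" "a \<in> Range (\<Phi> (Suc (to_nat a)) x)"
      using \<Phi>Q[of "to_nat a"] x by (auto simp: Q_def)
    then show "\<exists>n. a \<in> Domain (\<Phi> n x)" "\<exists>n. a \<in> Range (\<Phi> n x)" by blast+
  qed (use \<Phi> x in blast)+
  then obtain b where b: "\<And>x. x \<in> X \<Longrightarrow> b x \<in> automorphisms M"
      "\<And>x n. x \<in> X \<Longrightarrow> extends_graph (b x) (\<Phi> n x)"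
    by metis
  show thesis
  proof (rule that[of b])
    fix N \<phi> assume \<phi>: "\<And>i. i \<in> c N ` X \<Longrightarrow> partial_automorphism M (\<phi> i)"
    have "\<exists>ps. i \<in> c N ` X \<longrightarrow> set ps = \<phi> i" for i
      using \<phi>[of i] finite_list by (auto simp: partial_automorphism_def)
    then obtain L where L: "\<And>i. i \<in> c N ` X \<Longrightarrow> set (L i) = \<phi> i" by metis
    obtain K where K: "c N ` X \<subseteq> {..<K}"
      using fin[of N] finite_nat_iff_bounded by blast
    define t where "t = map L [0..<K]"
    have t: "set (t ! i) = \<phi> i" if "i \<in> c N ` X" for i
      using that K L by (auto simp: t_def)
    define n where "n = prod_encode (N, to_nat (N, t))"
    have "N \<le> n" by (simp add: n_def le_prod_encode_1)
    moreover have "target n = (N, t)" by (simp add: target_def n_def)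
    ultimately have "\<Psi> n x = \<phi> (c N x)" if "x \<in> X" for x
      using t[of "c N x"] \<phi>[of "c N x"] that by (simp add: \<Psi>_def)
    moreover obtain l where "\<And>x h. x \<in> X \<Longrightarrow> extends_graph h (\<Phi> (Suc n) x) \<Longrightarrow>
        extends_graph (aut_conj M g l h) (\<Psi> n x)"
      using \<Phi>Q[of n] unfolding Q_def by blast
    ultimately show "\<exists>l. \<forall>x\<in>X. extends_graph (aut_conj M g l (b x)) (\<phi> (c N x))"
      using b(2) by metis
  next
    fix a :: 'a
    let ?N = "Suc (to_nat a)"
    have "b x a = b y a" if xy: "x \<in> X" "y \<in> X" "c ?N x = c ?N y" for x y
    proof -
      have "z (to_nat a) = a" by (simp add: z_def)
      then obtain v where "(a, v) \<in> \<Phi> ?N x" using \<Phi>Q[of "to_nat a"] xy(1) by (auto simp: Q_def)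
      moreover have "\<Phi> ?N x = \<Phi> ?N y" using \<Phi>P[of ?N] xy unfolding P_def by blast
      ultimately show ?thesis
        using b(2)[OF xy(1), of ?N] b(2)[OF xy(2), of ?N] by (auto simp: extends_graph_def)
    qed
    then show "\<exists>N. \<forall>x\<in>X. \<forall>y\<in>X. c N x = c N y \<longrightarrow> b x a = b y a" by blast
  qed (use b in auto)
qed

text \<open>A word that is trivial on \<open>(g, b)\<close> is trivial on every pair \<open>(g, g\<^sup>l b g\<^sup>-\<^sup>l)\<close>, since conjugation by
  \<open>g\<^sup>l\<close> fixes \<open>g\<close>. As these conjugates are dense, freeness costs no further construction.\<close>

lemma generic_free:
  assumes g: "g \<in> automorphisms M" and na: "no_algebraicity M" and nc: "no_cycles g"
    and b: "b \<in> automorphisms M"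
    and dense: "\<And>p. partial_automorphism M p \<Longrightarrow> \<exists>l. extends_graph (aut_conj M g l b) p"
    and w: "reduced_word w" "w \<noteq> []"
  shows "word_value (aut_group M) g b w \<noteq> id"
proof
  assume id: "word_value (aut_group M) g b w = id"
  obtain h A x where h: "h \<in> automorphisms M" "finite A"
    "\<forall>h'\<in>automorphisms M. (\<forall>a\<in>A. h' a = h a) \<longrightarrow> word_value (aut_group M) g h' w x \<noteq> x"
    using ex_word_moves_point[OF na g nc w] .
  have "partial_automorphism M ((\<lambda>a. (a, h a)) ` A)"
    using h(1,2) by (auto simp: partial_automorphism_def extends_graph_def)
  then obtain l where l: "\<forall>a\<in>A. aut_conj M g l b a = h a"
    using dense by (fastforce simp: extends_graph_def)
  have "aut_conj M g l (h \<circ> k) = aut_conj M g l h \<circ> aut_conj M g l k" for h k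
    by (simp add: aut_conj_def fun_eq_iff g)
  then have hom: "aut_conj M g l \<in> hom (aut_group M) (aut_group M)"
    by (intro homI) (auto simp: aut_conj_closed[OF g])
  have "aut_conj M g l g = g"
    using aut_int_pow_add[OF g, of 1] aut_int_pow_add[OF g, of _ 1]
    by (simp add: aut_conj_def fun_eq_iff aut_int_pow_1[OF g] aut_int_pow_add[OF g])
  then have "word_value (aut_group M) g (aut_conj M g l b) w = aut_conj M g l id"
    using word_value_hom[OF group_aut_group group_aut_group hom, of g b w] g b id by simp
  also have "\<dots> = id"
    by (simp add: aut_conj_def fun_eq_iff g)
  finally show False
    using h(3) aut_conj_closed[OF g b] l by force
qed

section \<open>Finite powers of the automorphism group\<close>

lemma group_power_group: "group G \<Longrightarrow> group (power_group n G)"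
  by (simp add: power_group_def)

lemma power_group_projection:
  assumes "group G" "i \<in> {1..n}"
  shows "(\<lambda>x. x i) \<in> hom (power_group n G) G"
  using assms(2) by (intro homI) (auto simp: power_group_def PiE_iff)

lemma power_group_conj:
  assumes g: "g \<in> automorphisms M" and b: "b \<in> carrier (power_group n (aut_group M))" and i: "i \<in> {1..n}"
  shows "((\<lambda>i\<in>{1..n}. g) [^]\<^bsub>power_group n (aut_group M)\<^esub> l \<otimes>\<^bsub>power_group n (aut_group M)\<^esub> b
      \<otimes>\<^bsub>power_group n (aut_group M)\<^esub> (\<lambda>i\<in>{1..n}. g) [^]\<^bsub>power_group n (aut_group M)\<^esub> (- l :: int)) i
    = aut_conj M g l (b i)"
proof -
  interpret group_hom "power_group n (aut_group M)" "aut_group M" "\<lambda>x. x i"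
    by (intro group_hom.intro group_hom_axioms.intro group_power_group group_aut_group
        power_group_projection i)
  have gbar: "(\<lambda>i\<in>{1..n}. g) \<in> carrier (power_group n (aut_group M))"
    using g by (simp add: power_group_def)
  have "((\<lambda>i\<in>{1..n}. g) [^]\<^bsub>power_group n (aut_group M)\<^esub> k) i = g [^]\<^bsub>aut_group M\<^esub> (k :: int)" for k
    using hom_int_pow[OF gbar, of k] i by simp
  then show ?thesis
    using hom_mult b gbar by (simp add: aut_conj_def)
qed

lemma power_group_generic:
  fixes M :: "('f, 'r, 'a :: countable) fo_structure"
  assumes am: "conjugates_amalgamate M g" and g: "g \<in> automorphisms M" and n: "n \<ge> 1"
  obtains b where "cyclically_generates
      (power_group n (aut_group M)) (power_topology n (aut_topology M)) (\<lambda>i\<in>{1..n}. g) b"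
    and "no_algebraicity M \<Longrightarrow> no_cycles g \<Longrightarrow>
      freely_generate (power_group n (aut_group M)) (\<lambda>i\<in>{1..n}. g) b"
proof -
  let ?P = "power_group n (aut_group M)" and ?g = "\<lambda>i\<in>{1..n}. g"
  let ?T = "power_topology n (aut_topology M)"
  obtain b where b: "\<And>i. i \<in> {1..n} \<Longrightarrow> b i \<in> automorphisms M"
    and approx: "\<And>\<phi>. (\<And>i. i \<in> {1..n} \<Longrightarrow> partial_automorphism M (\<phi> i)) \<Longrightarrow>
        \<exists>l. \<forall>i\<in>{1..n}. extends_graph (aut_conj M g l (b i)) (\<phi> i)"
    by (rule generic_map[OF am g, of "\<lambda>_ i. i" "{1..n}"]) auto
  define bb where "bb = (\<lambda>i\<in>{1..n}. b i)"
  interpret P: group ?P by (rule group_power_group[OF group_aut_group])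
  have carrier: "carrier ?P = (\<Pi>\<^sub>E i\<in>{1..n}. automorphisms M)"
    by (simp add: power_group_def)
  have gc: "?g \<in> carrier ?P" and bc: "bb \<in> carrier ?P"
    using g b by (auto simp: carrier bb_def)
  define C where "C l = ?g [^]\<^bsub>?P\<^esub> l \<otimes>\<^bsub>?P\<^esub> bb \<otimes>\<^bsub>?P\<^esub> ?g [^]\<^bsub>?P\<^esub> (- l)" for l :: int
  have Cc: "C l \<in> carrier ?P" for l
    using gc bc by (simp add: C_def)
  have Ci: "C l i = aut_conj M g l (b i)" if "i \<in> {1..n}" for l i
    using power_group_conj[OF g bc that] that by (simp add: C_def bb_def)
  have "\<exists>l. C l \<in> U" if U: "openin ?T U" "H \<in> U" and H: "H \<in> carrier ?P" for U H
  proof -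
    obtain V where V: "\<And>i. i \<in> {1..n} \<Longrightarrow> openin (aut_topology M) (V i)"
        "H \<in> Pi\<^sub>E {1..n} V" "Pi\<^sub>E {1..n} V \<subseteq> U"
      using bspec[OF U(1)[unfolded power_topology_def openin_product_topology_alt] U(2)] by blast
    have "\<exists>F. finite F \<and> (\<forall>k\<in>automorphisms M. (\<forall>x\<in>F. k x = H i x) \<longrightarrow> k \<in> V i)"
      if "i \<in> {1..n}" for i
      using V(1)[OF that] V(2) that unfolding openin_aut_topology_iff by (auto simp: PiE_iff)
    then obtain F where F: "\<And>i. i \<in> {1..n} \<Longrightarrow> finite (F i)"
        "\<And>i k. i \<in> {1..n} \<Longrightarrow> k \<in> automorphisms M \<Longrightarrow> \<forall>x\<in>F i. k x = H i x \<Longrightarrow> k \<in> V i"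
      by metis
    have Ha: "H i \<in> automorphisms M" if "i \<in> {1..n}" for i
      using H that by (auto simp: carrier PiE_iff)
    have "partial_automorphism M ((\<lambda>x. (x, H i x)) ` F i)" if "i \<in> {1..n}" for i
      using F(1)[OF that] Ha[OF that] by (auto simp: partial_automorphism_def extends_graph_def)
    from approx[of "\<lambda>i. (\<lambda>x. (x, H i x)) ` F i", OF this]
    obtain l where "\<forall>i\<in>{1..n}. extends_graph (aut_conj M g l (b i)) ((\<lambda>x. (x, H i x)) ` F i)"
      by blast
    then have "C l i \<in> V i" if "i \<in> {1..n}" for i
      using F(2)[OF that aut_conj_closed[OF g b[OF that]]] that
      by (auto simp: Ci[OF that] extends_graph_def)
    moreover have "C l \<in> extensional {1..n}"
      using Cc[of l] by (auto simp: carrier PiE_iff)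
    ultimately have "C l \<in> Pi\<^sub>E {1..n} V" by (auto simp: PiE_iff)
    then show ?thesis using V(3) by blast
  qed
  moreover have "topspace ?T = carrier ?P"
    by (simp add: power_topology_def carrier)
  ultimately have "?T closure_of {C l | l. True} = carrier ?P"
    by (fastforce simp: closure_of_def)
  then have "cyclically_generates ?P ?T ?g bb"
    using gc bc by (simp add: cyclically_generates_def C_def)
  moreover have "freely_generate ?P ?g bb" if na: "no_algebraicity M" "no_cycles g"
    unfolding freely_generate_def
  proof (intro conjI allI impI gc bc)
    fix w assume w: "reduced_word w \<and> w \<noteq> []"
    have 1: "1 \<in> {1..n}" using n by simp
    have dense: "\<exists>l. extends_graph (aut_conj M g l (b 1)) p" if "partial_automorphism M p" for p
      using approx[of "\<lambda>_. p"] that 1 by blast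
    have "word_value (aut_group M) g (b 1) w \<noteq> id"
      using generic_free[OF g na b[OF 1]] dense w by blast
    moreover have "word_value ?P ?g bb w 1 = word_value (aut_group M) (?g 1) (bb 1) w"
      by (rule word_value_hom[OF P.is_group group_aut_group power_group_projection[OF group_aut_group 1] gc bc])
    ultimately have "word_value ?P ?g bb w 1 \<noteq> \<one>\<^bsub>?P\<^esub> 1"
      using 1 by (simp add: bb_def power_group_def)
    then show "word_value ?P ?g bb w \<noteq> \<one>\<^bsub>?P\<^esub>" by metis
  qed
  ultimately show thesis by (rule that)
qed

section \<open>The group of measurable maps into the automorphism group\<close>

lemma unit_interval_measurable: "{x :: real. 0 \<le> x \<and> x \<le> 1} \<in> sets unit_interval_measure"
proof -
  have "{x :: real. 0 \<le> x \<and> x \<le> 1} = space unit_interval_measure" by auto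
  then show ?thesis by (metis sets.top)
qed

text \<open>Measurability into \<open>Aut(M)\<close> only has to be tested on the countably many subbasic open sets
  \<open>{h. h a = y}\<close>.\<close>

lemma L0_maps_aut_iff:
  fixes M :: "('f, 'r, 'a :: countable) fo_structure"
  shows "f \<in> L0_maps (aut_topology M) \<longleftrightarrow> (\<forall>x\<in>{0..1}. f x \<in> automorphisms M) \<and>
    (\<forall>a y. {x \<in> {0..1}. f x a = y} \<in> sets unit_interval_measure)"
  (is "_ \<longleftrightarrow> ?V \<and> ?S")
proof
  have opens: "{U. openin (aut_topology M) U} \<subseteq> Pow (topspace (aut_topology M))"
    using openin_subset by blast
  assume f: "f \<in> L0_maps (aut_topology M)"
  have V: ?V
    using measurable_space[of f unit_interval_measure] f
    by (fastforce simp: L0_maps_def borel_of_topology_def space_measure_of_conv)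
  have "{x \<in> {0..1}. f x a = y} \<in> sets unit_interval_measure" for a y
  proof -
    have "openin (aut_topology M) {h \<in> automorphisms M. h a = y}"
      unfolding openin_aut_topology_iff by (auto intro!: exI[of _ "{a}"])
    then have "{h \<in> automorphisms M. h a = y} \<in> sets (borel_of_topology (aut_topology M))"
      unfolding borel_of_topology_def sets_measure_of[OF opens] by (intro sigma_sets.Basic) simp
    then have "f -` {h \<in> automorphisms M. h a = y} \<inter> space unit_interval_measure
        \<in> sets unit_interval_measure"
      using f unfolding L0_maps_def by (intro measurable_sets)
    moreover have "f -` {h \<in> automorphisms M. h a = y} \<inter> space unit_interval_measure =
        {x \<in> {0..1}. f x a = y}"
      using V by auto
    ultimately show ?thesis by simp
  qed
  with V show "?V \<and> ?S" by blast
next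
  assume R: "?V \<and> ?S"
  show "f \<in> L0_maps (aut_topology M)"
    unfolding L0_maps_def borel_of_topology_def
  proof (rule measurable_measure_of)
    show "{U. openin (aut_topology M) U} \<subseteq> Pow (topspace (aut_topology M))"
      using openin_subset by blast
    show "f \<in> space unit_interval_measure \<rightarrow> topspace (aut_topology M)"
      using R by auto
    fix U assume "U \<in> {U. openin (aut_topology M) U}"
    then have U: "openin (aut_topology M) U" by simp
    (* An open set is a countable union of sets of the form {k. k extends the graph p}. *)
    define I where "I = {p. \<forall>k\<in>automorphisms M. extends_graph k (set p) \<longrightarrow> k \<in> U}"
    have "{x \<in> {0..1}. extends_graph (f x) (set p)} \<in> sets unit_interval_measure" for p
    proof (induction p)
      case (Cons q p)
      have "{x \<in> {0..1}. extends_graph (f x) (set (q # p))} =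
          {x \<in> {0..1}. f x (fst q) = snd q} \<inter> {x \<in> {0..1}. extends_graph (f x) (set p)}"
        by (auto simp: extends_graph_def)
      then show ?case using Cons.IH R by (simp only: sets.Int)
    qed (simp add: extends_graph_def unit_interval_measurable)
    then have "(\<Union>p\<in>I. {x \<in> {0..1}. extends_graph (f x) (set p)}) \<in> sets unit_interval_measure"
      by (intro sets.countable_UN'') auto
    moreover have "f -` U \<inter> space unit_interval_measure =
        (\<Union>p\<in>I. {x \<in> {0..1}. extends_graph (f x) (set p)})"
    proof (intro equalityI subsetI)
      fix x assume x: "x \<in> f -` U \<inter> space unit_interval_measure"
      then obtain F where F: "finite F" "\<forall>k\<in>automorphisms M. (\<forall>a\<in>F. k a = f x a) \<longrightarrow> k \<in> U"
        using U unfolding openin_aut_topology_iff by blast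
      obtain as where as: "set as = F" using finite_list[OF F(1)] by blast
      define p where "p = map (\<lambda>a. (a, f x a)) as"
      have "p \<in> I" "extends_graph (f x) (set p)"
        using F(2) as by (auto simp: I_def p_def extends_graph_def)
      then show "x \<in> (\<Union>p\<in>I. {x \<in> {0..1}. extends_graph (f x) (set p)})" using x by auto
    qed (use R in \<open>auto simp: I_def\<close>)
    ultimately show "f -` U \<inter> space unit_interval_measure \<in> sets unit_interval_measure" by simp
  qed
qed

lemma L0_maps_const:
  fixes M :: "('f, 'r, 'a :: countable) fo_structure"
  assumes "k \<in> automorphisms M"
  shows "(\<lambda>_. k) \<in> L0_maps (aut_topology M)"
proof -
  have "{x \<in> {0..1}. k a = y} \<in> sets unit_interval_measure" for a y
    using unit_interval_measurable by (cases "k a = y") auto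
  with assms show ?thesis by (auto simp: L0_maps_aut_iff)
qed

lemma L0_maps_comp:
  fixes M :: "('f, 'r, 'a :: countable) fo_structure"
  assumes f: "f \<in> L0_maps (aut_topology M)" and h: "h \<in> L0_maps (aut_topology M)"
  shows "(\<lambda>x. f x \<circ> h x) \<in> L0_maps (aut_topology M)"
proof -
  have "{x \<in> {0..1}. (f x \<circ> h x) a = y} \<in> sets unit_interval_measure" for a y
  proof -
    have "{x \<in> {0..1}. (f x \<circ> h x) a = y} =
        (\<Union>z. {x \<in> {0..1}. h x a = z} \<inter> {x \<in> {0..1}. f x z = y})"
      by auto
    also have "\<dots> \<in> sets unit_interval_measure"
      using f h by (intro sets.countable_UN'' sets.Int) (auto simp: L0_maps_aut_iff)
    finally show ?thesis .
  qed
  then show ?thesis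
    using f h by (auto simp: L0_maps_aut_iff automorphism_comp)
qed

lemma L0_maps_inv:
  fixes M :: "('f, 'r, 'a :: countable) fo_structure"
  assumes f: "f \<in> L0_maps (aut_topology M)"
  shows "(\<lambda>x. inv\<^bsub>aut_group M\<^esub> f x) \<in> L0_maps (aut_topology M)"
proof -
  have fa: "f x \<in> automorphisms M" if "x \<in> {0..1}" for x
    using f that by (simp add: L0_maps_aut_iff)
  have "(inv\<^bsub>aut_group M\<^esub> f x) a = y \<longleftrightarrow> f x y = a" if "x \<in> {0..1}" for x a y
    using automorphism_bij[OF fa[OF that]] inv_aut_group[OF fa[OF that]] by (metis bij_inv_eq_iff)
  then have "{x \<in> {0..1}. (inv\<^bsub>aut_group M\<^esub> f x) a = y} = {x \<in> {0..1}. f x y = a}" for a y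
    by auto
  then show ?thesis
    using f fa by (auto simp: L0_maps_aut_iff inv_aut_group automorphism_inv)
qed

lemma equiv_L0_rel: "equiv (L0_maps T) (L0_rel T)"
proof (rule equivI)
  show "L0_rel T \<subseteq> L0_maps T \<times> L0_maps T" by (auto simp: L0_rel_def)
  show "refl_on (L0_maps T) (L0_rel T)" by (auto simp: L0_rel_def refl_on_def)
  show "sym (L0_rel T)" by (auto simp: L0_rel_def sym_def elim: AE_mp)
  show "trans (L0_rel T)"
  proof (rule transI)
    fix f h k assume "(f, h) \<in> L0_rel T" "(h, k) \<in> L0_rel T"
    then have "AE x in unit_interval_measure. f x = h x" "AE x in unit_interval_measure. h x = k x"
      "f \<in> L0_maps T" "k \<in> L0_maps T"
      by (auto simp: L0_rel_def)
    moreover from this(1,2) have "AE x in unit_interval_measure. f x = k x" by eventually_elim simp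
    ultimately show "(f, k) \<in> L0_rel T" by (simp add: L0_rel_def)
  qed
qed

definition L0_class :: "('f, 'r, 'a) fo_structure \<Rightarrow> (real \<Rightarrow> 'a \<Rightarrow> 'a) \<Rightarrow> (real \<Rightarrow> 'a \<Rightarrow> 'a) set" where
  "L0_class M f = L0_rel (aut_topology M) `` {f}"

abbreviation L0_aut :: "('f, 'r, 'a) fo_structure \<Rightarrow> (real \<Rightarrow> 'a \<Rightarrow> 'a) set monoid" where
  "L0_aut M \<equiv> L0_group (aut_group M) (aut_topology M)"

lemma carrier_L0_aut: "carrier (L0_aut M) = L0_class M ` L0_maps (aut_topology M)"
  by (auto simp: L0_group_def quotient_def L0_class_def)

lemma one_L0_aut: "\<one>\<^bsub>L0_aut M\<^esub> = L0_class M (\<lambda>_. id)"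
  by (simp add: L0_group_def L0_class_def)

lemma L0_class_eq_iff:
  assumes "f \<in> L0_maps (aut_topology M)" "h \<in> L0_maps (aut_topology M)"
  shows "L0_class M f = L0_class M h \<longleftrightarrow> (AE x in unit_interval_measure. f x = h x)"
  using assms eq_equiv_class_iff[OF equiv_L0_rel assms]
  by (simp add: L0_class_def) (simp add: L0_rel_def)

lemma L0_class_self: "f \<in> L0_maps (aut_topology M) \<Longrightarrow> f \<in> L0_class M f"
  by (simp add: L0_class_def L0_rel_def)

lemma mult_L0_aut:
  fixes M :: "('f, 'r, 'a :: countable) fo_structure"
  assumes "f \<in> L0_maps (aut_topology M)" "h \<in> L0_maps (aut_topology M)"
  shows "L0_class M f \<otimes>\<^bsub>L0_aut M\<^esub> L0_class M h = L0_class M (\<lambda>x. f x \<circ> h x)"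
proof -
  let ?R = "L0_rel (aut_topology M)"
  have "congruent2 ?R ?R (\<lambda>f h. ?R `` {\<lambda>x. f x \<circ> h x})"
  proof (rule congruent2I[OF equiv_L0_rel equiv_L0_rel])
    fix f f' h assume A: "(f, f') \<in> ?R" "h \<in> L0_maps (aut_topology M)"
    then have "AE x in unit_interval_measure. f x = f' x" "f \<in> L0_maps (aut_topology M)"
        "f' \<in> L0_maps (aut_topology M)"
      by (auto simp: L0_rel_def)
    then have "AE x in unit_interval_measure. f x \<circ> h x = f' x \<circ> h x"
      "AE x in unit_interval_measure. h x \<circ> f x = h x \<circ> f' x"
      by auto
    then show "?R `` {\<lambda>x. f x \<circ> h x} = ?R `` {\<lambda>x. f' x \<circ> h x}"
      "?R `` {\<lambda>x. h x \<circ> f x} = ?R `` {\<lambda>x. h x \<circ> f' x}"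
      using A(2) \<open>f \<in> _\<close> \<open>f' \<in> _\<close>
      by (simp_all flip: L0_class_def add: L0_class_eq_iff L0_maps_comp)
  qed
  from UN_equiv_class2[OF equiv_L0_rel equiv_L0_rel this assms]
  show ?thesis by (simp add: L0_group_def L0_class_def)
qed

lemma group_L0_aut:
  fixes M :: "('f, 'r, 'a :: countable) fo_structure"
  shows "group (L0_aut M)"
proof (rule groupI)
  fix F assume "F \<in> carrier (L0_aut M)"
  then obtain f where f: "f \<in> L0_maps (aut_topology M)" "F = L0_class M f"
    by (auto simp: carrier_L0_aut)
  let ?k = "\<lambda>x. inv\<^bsub>aut_group M\<^esub> f x"
  have k: "?k \<in> L0_maps (aut_topology M)" by (rule L0_maps_inv[OF f(1)])
  have "AE x in unit_interval_measure. ?k x \<circ> f x = id"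
    using group.l_inv[OF group_aut_group, of _ M] f by (intro AE_I2) (simp add: L0_maps_aut_iff)
  then have "L0_class M (\<lambda>x. ?k x \<circ> f x) = L0_class M (\<lambda>_. id)"
    using L0_maps_comp[OF k f(1)] L0_maps_const[OF automorphism_id, of M]
    by (simp add: L0_class_eq_iff)
  then show "\<exists>K\<in>carrier (L0_aut M). K \<otimes>\<^bsub>L0_aut M\<^esub> F = \<one>\<^bsub>L0_aut M\<^esub>"
    using k by (intro bexI[of _ "L0_class M ?k"])
      (auto simp: f(2) mult_L0_aut[OF k f(1)] one_L0_aut carrier_L0_aut)
qed (auto simp: carrier_L0_aut one_L0_aut mult_L0_aut L0_maps_comp comp_assoc
    L0_maps_const[OF automorphism_id])

lemma inv_L0_aut:
  fixes M :: "('f, 'r, 'a :: countable) fo_structure"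
  assumes f: "f \<in> L0_maps (aut_topology M)"
  shows "inv\<^bsub>L0_aut M\<^esub> L0_class M f = L0_class M (\<lambda>x. inv\<^bsub>aut_group M\<^esub> f x)"
proof (rule group.inv_equality[OF group_L0_aut])
  let ?k = "\<lambda>x. inv\<^bsub>aut_group M\<^esub> f x"
  have k: "?k \<in> L0_maps (aut_topology M)" by (rule L0_maps_inv[OF f(1)])
  have "AE x in unit_interval_measure. ?k x \<circ> f x = id"
    using group.l_inv[OF group_aut_group, of _ M] f by (intro AE_I2) (simp add: L0_maps_aut_iff)
  then show "L0_class M ?k \<otimes>\<^bsub>L0_aut M\<^esub> L0_class M f = \<one>\<^bsub>L0_aut M\<^esub>"
    using L0_maps_comp[OF k f(1)] L0_maps_const[OF automorphism_id, of M]
    by (simp add: mult_L0_aut[OF k f] one_L0_aut L0_class_eq_iff)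
  show "L0_class M f \<in> carrier (L0_aut M)" "L0_class M ?k \<in> carrier (L0_aut M)"
    using f k by (auto simp: carrier_L0_aut)
qed

text \<open>Words are evaluated pointwise on representatives. This cannot be deduced from evaluation
  homomorphisms, as evaluation at a point is not defined on classes of maps.\<close>

lemma word_value_L0_aut:
  fixes M :: "('f, 'r, 'a :: countable) fo_structure"
  assumes f: "f \<in> L0_maps (aut_topology M)" and h: "h \<in> L0_maps (aut_topology M)"
  shows "word_value (L0_aut M) (L0_class M f) (L0_class M h) w =
      L0_class M (\<lambda>x. word_value (aut_group M) (f x) (h x) w) \<and>
    (\<lambda>x. word_value (aut_group M) (f x) (h x) w) \<in> L0_maps (aut_topology M)"
proof (induction w)
  case Nil
  then show ?case
    using L0_maps_const[OF automorphism_id, of M]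
    by (simp only: word_value_simps one_L0_aut aut_group_simps simp_thms)
next
  case (Cons s w)
  have "letter_value (L0_aut M) (L0_class M f) (L0_class M h) s =
        L0_class M (\<lambda>x. letter_value (aut_group M) (f x) (h x) s) \<and>
      (\<lambda>x. letter_value (aut_group M) (f x) (h x) s) \<in> L0_maps (aut_topology M)"
    using f h by (cases s) (simp add: letter_value_def Let_def inv_L0_aut L0_maps_inv)
  then show ?case
    using Cons.IH by (simp only: word_value_simps aut_group_simps mult_L0_aut L0_maps_comp simp_thms)
qed

lemma L0_aut_conj:
  fixes M :: "('f, 'r, 'a :: countable) fo_structure"
  assumes g: "g \<in> automorphisms M" and b: "b \<in> L0_maps (aut_topology M)"
  shows "L0_class M (\<lambda>_. g) [^]\<^bsub>L0_aut M\<^esub> l \<otimes>\<^bsub>L0_aut M\<^esub> L0_class M b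
      \<otimes>\<^bsub>L0_aut M\<^esub> L0_class M (\<lambda>_. g) [^]\<^bsub>L0_aut M\<^esub> (- l :: int)
    = L0_class M (\<lambda>x. aut_conj M g l (b x))"
proof -
  interpret group_hom "aut_group M" "L0_aut M" "\<lambda>k. L0_class M (\<lambda>_. k)"
  proof (intro group_hom.intro group_hom_axioms.intro group_aut_group group_L0_aut homI)
    fix h k assume "h \<in> carrier (aut_group M)" "k \<in> carrier (aut_group M)"
    then show "L0_class M (\<lambda>_. h) \<in> carrier (L0_aut M)"
      "L0_class M (\<lambda>_. h \<otimes>\<^bsub>aut_group M\<^esub> k) = L0_class M (\<lambda>_. h) \<otimes>\<^bsub>L0_aut M\<^esub> L0_class M (\<lambda>_. k)"
      by (auto simp: carrier_L0_aut mult_L0_aut L0_maps_const)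
  qed
  have "L0_class M (\<lambda>_. g) [^]\<^bsub>L0_aut M\<^esub> k = L0_class M (\<lambda>_. g [^]\<^bsub>aut_group M\<^esub> (k :: int))" for k
    using hom_int_pow[of g k] g by simp
  then show ?thesis
    using g b by (simp add: mult_L0_aut L0_maps_const automorphism_int_pow L0_maps_comp aut_conj_def)
qed

section \<open>Approximation of measurable maps by dyadic step functions\<close>

definition dyadic_cell :: "nat \<Rightarrow> real \<Rightarrow> nat" where
  "dyadic_cell N x = nat \<lfloor>2 ^ N * x\<rfloor>"

lemma dyadic_cell_refine: "dyadic_cell N x = dyadic_cell (Suc N) x div 2"
proof -
  have "\<lfloor>2 ^ N * x\<rfloor> = \<lfloor>2 ^ Suc N * x\<rfloor> div 2"
    using floor_divide_real_eq_div[of 2 "2 ^ Suc N * x"] by simp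
  then show ?thesis
    by (simp add: dyadic_cell_def nat_div_distrib')
qed

lemma finite_dyadic_cells: "finite (dyadic_cell N ` {0..1})"
proof (rule finite_subset)
  show "dyadic_cell N ` {0..1} \<subseteq> {..2 ^ N}"
  proof (rule image_subsetI)
    fix x :: real assume "x \<in> {0..1}"
    then have "2 ^ N * x \<le> 2 ^ N" by simp
    then have "\<lfloor>2 ^ N * x\<rfloor> \<le> \<lfloor>2 ^ N :: real\<rfloor>" by (rule floor_mono)
    also have "\<lfloor>2 ^ N :: real\<rfloor> = 2 ^ N" by (metis floor_of_int of_int_numeral of_int_power)
    finally show "dyadic_cell N x \<in> {..2 ^ N}" by (simp add: dyadic_cell_def nat_le_iff)
  qed
qed simp

lemma dyadic_cell_dist:
  assumes "x \<ge> 0" "y \<ge> 0" "dyadic_cell N x = dyadic_cell N y"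
  shows "dist x y < (1 / 2) ^ N"
proof -
  have "\<lfloor>2 ^ N * x\<rfloor> = \<lfloor>2 ^ N * y\<rfloor>"
    using assms by (simp add: dyadic_cell_def eq_nat_nat_iff)
  then have "\<bar>2 ^ N * x - 2 ^ N * y\<bar> < 1" by linarith
  also have "2 ^ N * x - 2 ^ N * y = 2 ^ N * (x - y)" by (simp add: algebra_simps)
  finally have "2 ^ N * \<bar>x - y\<bar> < 1" by (simp add: abs_mult)
  then show ?thesis by (simp add: dist_real_def field_simps)
qed

lemma dyadic_cell_measurable: "{x \<in> {0..1}. dyadic_cell N x = i} \<in> sets unit_interval_measure"
proof -
  have "{x \<in> {0..1}. dyadic_cell N x = i} = {x \<in> space borel. dyadic_cell N x = i} \<inter> {0..1}" by auto
  moreover have "{x \<in> space borel. dyadic_cell N x = i} \<in> sets borel"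
    unfolding dyadic_cell_def by measurable
  ultimately show ?thesis by (auto simp: sets_restrict_space_iff)
qed

text \<open>Countably many sets, each given by a finite partial automorphism and with all distances less than
  \<open>\<delta>\<close>, cover \<open>Aut(M)\<close>. Their preimages under \<open>h\<close>, made disjoint, cover the unit interval; finitely many of them
  cover it up to measure \<open>\<epsilon> / 2\<close>, and each of these contains a compact set exhausting almost all of
  it. Finitely many disjoint compact sets are told apart by the dyadic cells of some level.\<close>

lemma step_approximation:
  fixes M :: "('f, 'r, 'a :: countable) fo_structure"
  assumes d: "compatible_complete_metric (aut_topology M) d"
    and h: "h \<in> L0_maps (aut_topology M)" and \<delta>: "\<delta> > 0" and \<epsilon>: "\<epsilon> > 0"
  obtains N \<phi> K where "\<And>i. partial_automorphism M (\<phi> i)"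
    and "K \<in> sets unit_interval_measure" "measure unit_interval_measure K > 1 - \<epsilon>"
    and "\<And>x k. x \<in> K \<Longrightarrow> k \<in> automorphisms M \<Longrightarrow> extends_graph k (\<phi> (dyadic_cell N x)) \<Longrightarrow> d k (h x) < \<delta>"
proof -
  let ?U = "unit_interval_measure"
  interpret Metric_space "automorphisms M" d
    using d by (simp add: compatible_complete_metric_def)
  have mT: "mtopology = aut_topology M"
    using d by (simp add: compatible_complete_metric_def)
  interpret U: finite_measure ?U
    by (rule finite_measureI) (simp add: emeasure_restrict_space)
  have ha: "h x \<in> automorphisms M" if "x \<in> {0..1}" for x
    using h that by (simp add: L0_maps_aut_iff)
  define small where "small p \<longleftrightarrow> (\<forall>k\<in>automorphisms M. \<forall>k'\<in>automorphisms M.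
      extends_graph k p \<longrightarrow> extends_graph k' p \<longrightarrow> d k k' < \<delta>)" for p
  have cover: "\<exists>p. finite p \<and> small p \<and> extends_graph k p" if k: "k \<in> automorphisms M" for k
  proof -
    have "openin (aut_topology M) (mball k (\<delta> / 2))"
      using openin_mball mT by metis
    moreover have "k \<in> mball k (\<delta> / 2)" using k \<delta> by simp
    ultimately obtain F where F: "finite F"
        "\<forall>k'\<in>automorphisms M. (\<forall>x\<in>F. k' x = k x) \<longrightarrow> k' \<in> mball k (\<delta> / 2)"
      unfolding openin_aut_topology_iff by blast
    let ?p = "(\<lambda>x. (x, k x)) ` F"
    have near: "d k k' < \<delta> / 2" if "k' \<in> automorphisms M" "extends_graph k' ?p" for k'
      using F(2) that by (auto simp: extends_graph_def)
    have "d k' k'' < \<delta>" if "k' \<in> automorphisms M" "k'' \<in> automorphisms M"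
      "extends_graph k' ?p" "extends_graph k'' ?p" for k' k''
      using near[OF that(1,3)] near[OF that(2,4)] triangle[OF that(1) k that(2)] commute[of k' k] by linarith
    then have "small ?p" by (simp add: small_def)
    then show ?thesis using F(1) by (intro exI[of _ ?p]) (auto simp: extends_graph_def)
  qed
  define p where "p n = (set (from_nat n) :: ('a \<times> 'a) set)" for n
  define E where "E n = (if small (p n) then {x \<in> {0..1}. extends_graph (h x) (p n)} else {})" for n
  have "{x \<in> {0..1}. extends_graph (h x) (set q)} \<in> sets ?U" for q
  proof (induction q)
    case (Cons e q)
    have "{x \<in> {0..1}. extends_graph (h x) (set (e # q))} =
        {x \<in> {0..1}. h x (fst e) = snd e} \<inter> {x \<in> {0..1}. extends_graph (h x) (set q)}"
      by (auto simp: extends_graph_def)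
    then show ?case using Cons.IH h by (simp only: sets.Int L0_maps_aut_iff)
  qed (simp add: extends_graph_def unit_interval_measurable)
  then have E: "E n \<in> sets ?U" for n by (simp add: E_def p_def)
  have UE: "(\<Union>n. E n) = {0..1}"
  proof (intro equalityI subsetI)
    fix x :: real assume x: "x \<in> {0..1}"
    obtain q where "finite q" "small q" "extends_graph (h x) q" using cover[OF ha[OF x]] by blast
    moreover obtain qs where "set qs = q" using finite_list[OF \<open>finite q\<close>] by blast
    ultimately have "x \<in> E (to_nat qs)" using x by (simp add: E_def p_def)
    then show "x \<in> (\<Union>n. E n)" by blast
  qed (auto simp: E_def split: if_splits)
  define A where "A = disjointed E"
  have A: "A n \<in> sets ?U" "A n \<subseteq> E n" for n
    using sets.range_disjointed_sets[of E ?U] E disjointed_subset[of E n] by (auto simp: A_def)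
  have "(\<lambda>m. measure ?U (\<Union>n\<in>{0..<m}. A n)) \<longlonglongrightarrow> measure ?U (\<Union>m. \<Union>n\<in>{0..<m}. A n)"
  proof (rule U.finite_Lim_measure_incseq)
    show "range (\<lambda>m. \<Union>n\<in>{0..<m}. A n) \<subseteq> sets ?U" using A(1) by blast
    show "incseq (\<lambda>m. \<Union>n\<in>{0..<m}. A n)" by (intro monoI UN_mono) auto
  qed
  moreover have "(\<Union>m. \<Union>n\<in>{0..<m}. A n) = {0..1}"
    unfolding UE[symmetric] UN_disjointed_eq[of E, symmetric] A_def by fastforce
  moreover have "measure ?U {0..1} = 1" by (simp add: measure_restrict_space)
  ultimately have "(\<lambda>m. measure ?U (\<Union>n\<in>{0..<m}. A n)) \<longlonglongrightarrow> 1" by simp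
  from order_tendstoD(1)[OF this, of "1 - \<epsilon> / 2"] \<epsilon>
  obtain m where m: "measure ?U (\<Union>n\<in>{0..<m}. A n) > 1 - \<epsilon> / 2"
    by (auto simp: eventually_sequentially)
  define \<eta> where "\<eta> = \<epsilon> / 2 / real (Suc m)"
  have \<eta>: "\<eta> > 0" using \<epsilon> by (simp add: \<eta>_def)
  have "\<exists>C. compact C \<and> C \<subseteq> A n \<and> C \<in> sets ?U \<and> measure ?U (A n - C) \<le> \<eta>" for n
  proof -
    have An: "A n \<in> sets lebesgue" "A n \<subseteq> {0..1}"
      using A(1)[of n] by (simp_all add: sets_restrict_space_iff)
    obtain C where C: "closed C" "C \<subseteq> A n" "A n - C \<in> lmeasurable" "emeasure lebesgue (A n - C) < ennreal \<eta>"
      using sets_lebesgue_inner_closed[OF An(1) \<eta>] .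
    have "bounded C" using C(2) An(2) by (meson bounded_closed_interval bounded_subset)
    moreover have "C \<in> sets ?U"
      using C An(2) by (auto simp: sets_restrict_space_iff)
    moreover have "measure ?U (A n - C) = measure lebesgue (A n - C)"
      using An(2) by (intro measure_restrict_space) auto
    moreover have "measure lebesgue (A n - C) \<le> \<eta>"
      using C(3,4) \<eta> by (simp add: emeasure_eq_measure2 ennreal_less_iff)
    ultimately show ?thesis
      using C(1,2) by (intro exI[of _ C]) (simp add: compact_eq_bounded_closed)
  qed
  then obtain C where C: "\<And>n. compact (C n)" "\<And>n. C n \<subseteq> A n" "\<And>n. C n \<in> sets ?U"
      "\<And>n. measure ?U (A n - C n) \<le> \<eta>"
    by metis
  define K where "K = (\<Union>n\<in>{0..<m}. C n)"
  have K: "K \<in> sets ?U" unfolding K_def using C(3) by (intro sets.finite_UN) auto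
  have "measure ?U (\<Union>n\<in>{0..<m}. A n) \<le> measure ?U (K \<union> (\<Union>n\<in>{0..<m}. A n - C n))"
    using A(1) C(3) K by (intro U.finite_measure_mono) (auto simp: K_def)
  also have "\<dots> \<le> measure ?U K + measure ?U (\<Union>n\<in>{0..<m}. A n - C n)"
    using A(1) C(3) K by (intro measure_Un_le) auto
  also have "measure ?U (\<Union>n\<in>{0..<m}. A n - C n) \<le> (\<Sum>n\<in>{0..<m}. measure ?U (A n - C n))"
    using A(1) C(3) by (intro measure_UNION_le) auto
  also have "\<dots> \<le> (\<Sum>n\<in>{0..<m}. \<eta>)" by (intro sum_mono C(4))
  also have "\<dots> \<le> \<epsilon> / 2"
    using \<epsilon> by (simp add: \<eta>_def field_simps)
  finally have measK: "measure ?U K > 1 - \<epsilon>" using m by linarith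
  (* Disjoint compact sets lie at positive distance, so a fine dyadic cell meets at most one of them. *)
  have "\<exists>e>0. \<forall>x\<in>C i. \<forall>y\<in>C j. e \<le> dist x y" if "i < j" for i j
  proof (rule separate_compact_closed[OF C(1) compact_imp_closed[OF C(1)]])
    show "C i \<inter> C j = {}"
      using C(2)[of i] C(2)[of j] less_disjoint_disjointed[OF that, of E] by (auto simp: A_def)
  qed
  then obtain s where s: "\<And>i j. i < j \<Longrightarrow> s i j > (0 :: real)"
      "\<And>i j x y. i < j \<Longrightarrow> x \<in> C i \<Longrightarrow> y \<in> C j \<Longrightarrow> s i j \<le> dist x y"
    by metis
  define D where "D = insert 1 ((\<lambda>(i, j). s i j) ` {(i, j). i < j \<and> j < m})"
  have "{(i, j). i < j \<and> j < m} \<subseteq> {..<m} \<times> {..<m}" by auto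
  then have D: "finite D" by (simp add: D_def finite_subset)
  have "Min D > 0" using D s(1) by (subst Min_gr_iff) (auto simp: D_def)
  then obtain N where N: "(1 / 2 :: real) ^ N < Min D"
    using real_arch_pow_inv[of "Min D" "1 / 2"] by auto
  have far: "Min D \<le> dist x y" if "x \<in> C i" "y \<in> C j" "i < j" "j < m" for x y i j
  proof -
    have "s i j \<in> D" using that by (auto simp: D_def)
    then show ?thesis using Min_le[OF D] s(2)[OF that(3,1,2)] by fastforce
  qed
  have C01: "x \<in> {0..1}" if "x \<in> C i" for x i
    using that C(2) A(2) UE by blast
  have sep: "i = j" if "x \<in> C i" "y \<in> C j" "i < m" "j < m" "dyadic_cell N x = dyadic_cell N y" for x y i j
  proof -
    have "dist x y < Min D"
      using dyadic_cell_dist[of x y N] C01 that N by fastforce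
    then show ?thesis
      using far[of x i y j] far[of y j x i] that by (metis dist_commute linorder_neqE_nat not_less)
  qed
  define \<phi> where "\<phi> i = (if \<exists>n<m. \<exists>x\<in>C n. dyadic_cell N x = i
      then p (SOME n. n < m \<and> (\<exists>x\<in>C n. dyadic_cell N x = i)) else {})" for i
  have \<phi>: "\<phi> (dyadic_cell N x) = p n" if "x \<in> C n" "n < m" for x n
  proof -
    have "(SOME n'. n' < m \<and> (\<exists>y\<in>C n'. dyadic_cell N y = dyadic_cell N x)) = n"
      using that sep by (intro some_equality) blast+
    then show ?thesis using that by (auto simp: \<phi>_def)
  qed
  have CE: "small (p n)" "extends_graph (h x) (p n)" if "x \<in> C n" for x n
    using that C(2)[of n] A(2)[of n] by (auto simp: E_def split: if_splits)
  show thesis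
  proof (rule that[of \<phi> K N])
    show "partial_automorphism M (\<phi> i)" for i
    proof (cases "\<exists>n<m. \<exists>x\<in>C n. dyadic_cell N x = i")
      case True
      then obtain n x where "n < m" "x \<in> C n" "dyadic_cell N x = i" by blast
      then have "\<phi> i = p n" "extends_graph (h x) (p n)" "h x \<in> automorphisms M"
        using \<phi> CE(2) ha C01 by auto
      then show ?thesis by (auto simp: partial_automorphism_def p_def)
    next
      case False
      then have "\<phi> i = {}" unfolding \<phi>_def by meson
      then show ?thesis
        using automorphism_id by (auto simp: partial_automorphism_def extends_graph_def)
    qed
    show "d k (h x) < \<delta>" if "x \<in> K" "k \<in> automorphisms M" "extends_graph k (\<phi> (dyadic_cell N x))" for x k
    proof -
      obtain n where n: "n < m" "x \<in> C n" using \<open>x \<in> K\<close> by (auto simp: K_def)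
      then show ?thesis
        using CE[OF n(2)] ha[OF C01[OF n(2)]] that(2,3) \<phi>[OF n(2,1)] by (simp add: small_def)
    qed
  qed (use K measK in auto)
qed

section \<open>Generation of the group of measurable maps\<close>

text \<open>The construction controls \<open>b x\<close> at every point \<open>x\<close>, and not only almost everywhere. Hence a word
  that is trivial on the class of \<open>b\<close> would be trivial on \<open>b x\<close> for some \<open>x\<close>, although each \<open>b x\<close>
  has a dense conjugacy orbit of its own.\<close>

lemma L0_aut_generic:
  fixes M :: "('f, 'r, 'a :: countable) fo_structure"
  assumes am: "conjugates_amalgamate M g" and g: "g \<in> automorphisms M"
    and d: "compatible_complete_metric (aut_topology M) d"
  obtains b where "cyclically_generates
      (L0_aut M) (L0_topology (aut_topology M) d) (L0_const (aut_topology M) g) b"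
    and "no_algebraicity M \<Longrightarrow> no_cycles g \<Longrightarrow>
      freely_generate (L0_aut M) (L0_const (aut_topology M) g) b"
proof -
  let ?U = "unit_interval_measure" and ?L = "L0_topology (aut_topology M) d"
  have refine: "dyadic_cell n x = dyadic_cell n y"
    if "dyadic_cell (Suc n) x = dyadic_cell (Suc n) y" for n x y
    using that dyadic_cell_refine[of n x] dyadic_cell_refine[of n y] by simp
  obtain b where b: "\<And>x. x \<in> {0..1} \<Longrightarrow> b x \<in> automorphisms M"
    and approx: "\<And>N \<phi>. (\<And>i. i \<in> dyadic_cell N ` {0..1} \<Longrightarrow> partial_automorphism M (\<phi> i)) \<Longrightarrow>
        \<exists>l. \<forall>x\<in>{0..1}. extends_graph (aut_conj M g l (b x)) (\<phi> (dyadic_cell N x))"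
    and cell: "\<And>a. \<exists>N. \<forall>x\<in>{0..1}. \<forall>y\<in>{0..1}. dyadic_cell N x = dyadic_cell N y \<longrightarrow> b x a = b y a"
    using generic_map[OF am g, of dyadic_cell "{0..1}", OF finite_dyadic_cells refine] by metis
  have "{x \<in> {0..1}. b x a = y} \<in> sets ?U" for a y
  proof -
    obtain N where N: "\<And>x z. x \<in> {0..1} \<Longrightarrow> z \<in> {0..1} \<Longrightarrow> dyadic_cell N x = dyadic_cell N z \<Longrightarrow> b x a = b z a"
      using cell by blast
    let ?I = "dyadic_cell N ` {x \<in> {0..1}. b x a = y}"
    have "finite ?I" using finite_dyadic_cells[of N] by (rule finite_subset[rotated]) auto
    moreover have "{x \<in> {0..1}. b x a = y} = (\<Union>i\<in>?I. {x \<in> {0..1}. dyadic_cell N x = i})"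
      using N by auto
    ultimately show ?thesis
      using dyadic_cell_measurable by (metis (no_types, lifting) sets.finite_UN)
  qed
  then have bm: "b \<in> L0_maps (aut_topology M)"
    using b by (simp add: L0_maps_aut_iff)
  have bc: "(\<lambda>x. aut_conj M g l (b x)) \<in> L0_maps (aut_topology M)" for l
    using L0_maps_comp[OF L0_maps_comp[OF L0_maps_const bm] L0_maps_const] automorphism_int_pow[OF g]
    by (simp add: aut_conj_def)
  have const: "L0_const (aut_topology M) g = L0_class M (\<lambda>_. g)"
    by (simp add: L0_const_def L0_class_def)
  have gm: "(\<lambda>_. g) \<in> L0_maps (aut_topology M)" by (rule L0_maps_const[OF g])
  define C where "C l = L0_class M (\<lambda>x. aut_conj M g l (b x))" for l
  have Cc: "C l \<in> carrier (L0_aut M)" for l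
    using bc by (auto simp: C_def carrier_L0_aut)
  have openin: "openin ?L = L0_open (aut_topology M) d"
    unfolding L0_topology_def
    by (rule topology_inverse'[OF istopology_L0_open[OF d second_countable_aut_topology]])
  have quot: "carrier (L0_aut M) = L0_maps (aut_topology M) // L0_rel (aut_topology M)"
    by (simp add: L0_group_def)
  have "L0_open (aut_topology M) d (carrier (L0_aut M))"
    unfolding L0_open_def quot by (auto simp: L0_nbhd_def intro!: exI[of _ 1])
  then have top: "topspace ?L = carrier (L0_aut M)"
    unfolding topspace_def openin by (auto simp: L0_open_def quot)
  have "\<exists>l. C l \<in> V" if V: "openin ?L V" "H \<in> V" for V H
  proof -
    have "H \<in> carrier (L0_aut M)" using V openin_subset top by blast
    then obtain h where h: "h \<in> L0_maps (aut_topology M)" "H = L0_class M h"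
      by (auto simp: carrier_L0_aut)
    obtain \<delta> \<epsilon> where \<delta>\<epsilon>: "\<delta> > 0" "\<epsilon> > 0" "L0_nbhd (aut_topology M) d H \<delta> \<epsilon> \<subseteq> V"
      using V unfolding openin L0_open_def by blast
    obtain N \<phi> K where \<phi>: "\<And>i. partial_automorphism M (\<phi> i)"
      and K: "K \<in> sets ?U" "measure ?U K > 1 - \<epsilon>"
      and close: "\<And>x k. x \<in> K \<Longrightarrow> k \<in> automorphisms M \<Longrightarrow>
        extends_graph k (\<phi> (dyadic_cell N x)) \<Longrightarrow> d k (h x) < \<delta>"
      by (rule step_approximation[OF d h(1) \<delta>\<epsilon>(1,2)]) blast
    obtain l where l: "\<forall>x\<in>{0..1}. extends_graph (aut_conj M g l (b x)) (\<phi> (dyadic_cell N x))"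
      using approx[of N \<phi>] \<phi> by blast
    have "K \<subseteq> {0..1}" using sets.sets_into_space[OF K(1)] by simp
    then have "K \<subseteq> {x \<in> {0..1}. d (aut_conj M g l (b x)) (h x) < \<delta>}"
      using close aut_conj_closed[OF g b] l by blast
    moreover have "finite_measure ?U"
      by (rule finite_measureI) (simp add: emeasure_restrict_space)
    ultimately have "measure ?U K \<le> measure ?U {x \<in> {0..1}. d (aut_conj M g l (b x)) (h x) < \<delta>}"
      using L0_dist_measurable[OF d second_countable_aut_topology bc h(1)]
      by (intro finite_measure.finite_measure_mono)
    then have "measure ?U {x \<in> {0..1}. d (aut_conj M g l (b x)) (h x) < \<delta>} > 1 - \<epsilon>"
      using K(2) by linarith
    then have "C l \<in> L0_nbhd (aut_topology M) d H \<delta> \<epsilon>"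
      using L0_class_self[OF bc[of l]] L0_class_self[OF h(1)] Cc[of l]
      unfolding L0_nbhd_def quot h(2) C_def
      by (intro CollectI conjI bexI[of _ "\<lambda>x. aut_conj M g l (b x)"] bexI[of _ h])
    then show ?thesis using \<delta>\<epsilon>(3) by blast
  qed
  then have "?L closure_of {C l | l. True} = carrier (L0_aut M)"
    unfolding closure_of_def top by fastforce
  then have "cyclically_generates (L0_aut M) ?L (L0_const (aut_topology M) g) (L0_class M b)"
    using gm bm by (auto simp: cyclically_generates_def const L0_aut_conj[OF g bm] C_def carrier_L0_aut)
  moreover have "freely_generate (L0_aut M) (L0_const (aut_topology M) g) (L0_class M b)"
    if na: "no_algebraicity M" "no_cycles g"
    unfolding freely_generate_def const
  proof (intro conjI allI impI notI)
    show "L0_class M (\<lambda>_. g) \<in> carrier (L0_aut M)" "L0_class M b \<in> carrier (L0_aut M)"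
      using gm bm by (auto simp: carrier_L0_aut)
    fix w assume w: "reduced_word w \<and> w \<noteq> []"
      and "word_value (L0_aut M) (L0_class M (\<lambda>_. g)) (L0_class M b) w = \<one>\<^bsub>L0_aut M\<^esub>"
    then have "L0_class M (\<lambda>x. word_value (aut_group M) g (b x) w) = L0_class M (\<lambda>_. id)"
      using word_value_L0_aut[OF gm bm, of w] by (simp only: one_L0_aut)
    then have "AE x in ?U. word_value (aut_group M) g (b x) w = id"
      using word_value_L0_aut[OF gm bm, of w] L0_maps_const[OF automorphism_id, of M]
      by (simp only: L0_class_eq_iff)
    moreover have "AE x in ?U. word_value (aut_group M) g (b x) w \<noteq> id"
    proof (rule AE_I2)
      fix x assume "x \<in> space ?U"
      then have x: "x \<in> {0..1}" by simp
      have "\<exists>l. extends_graph (aut_conj M g l (b x)) p" if "partial_automorphism M p" for p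
        using approx[of 0 "\<lambda>_. p"] that x by blast
      then show "word_value (aut_group M) g (b x) w \<noteq> id"
        using generic_free[OF g na b[OF x]] w by blast
    qed
    ultimately have "AE x in ?U. False" by eventually_elim simp
    then have "emeasure ?U (space ?U) = 0"
      by (subst (asm) AE_iff_measurable[OF sets.top]) auto
    then show False by (simp add: emeasure_restrict_space)
  qed
  ultimately show thesis by (rule that)
qed

section \<open>Cyclic and free generation\<close>

theorem theorem2p1:
  fixes M :: "('f, 'r, 'a :: countable) fo_structure"
    and g :: "'a \<Rightarrow> 'a"
  assumes "ultrahomogeneous M"
    and "g \<in> automorphisms M"
    and "\<And>(n::nat) (\<phi> :: nat \<Rightarrow> ('a \<times> 'a) set) (\<psi> :: nat \<Rightarrow> ('a \<times> 'a) set).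
           n \<ge> 1 \<Longrightarrow>
           (\<And>i. i \<in> {1..n} \<Longrightarrow> partial_automorphism M (\<phi> i)) \<Longrightarrow>
           (\<And>i. i \<in> {1..n} \<Longrightarrow> partial_automorphism M (\<psi> i)) \<Longrightarrow>
           \<exists>k m :: int. \<forall>i\<in>{1..n}. \<exists>h\<in>automorphisms M.
             extends_graph h (conj_partial M g k (\<phi> i) \<union> conj_partial M g m (\<psi> i))"
  shows "(\<forall>n\<ge>1. \<exists>b. cyclically_generates
            (power_group n (aut_group M)) (power_topology n (aut_topology M)) (\<lambda>i\<in>{1..n}. g) b) \<and>
         (\<forall>d. compatible_complete_metric (aut_topology M) d \<longrightarrow>
            (\<exists>b. cyclically_generates
               (L0_group (aut_group M) (aut_topology M)) (L0_topology (aut_topology M) d)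
               (L0_const (aut_topology M) g) b)) \<and>
         (no_algebraicity M \<and> no_cycles g \<longrightarrow>
            (\<forall>n\<ge>1. \<exists>b. cyclically_generates
               (power_group n (aut_group M)) (power_topology n (aut_topology M)) (\<lambda>i\<in>{1..n}. g) b \<and>
               freely_generate (power_group n (aut_group M)) (\<lambda>i\<in>{1..n}. g) b) \<and>
            (\<forall>d. compatible_complete_metric (aut_topology M) d \<longrightarrow>
               (\<exists>b. cyclically_generates
                  (L0_group (aut_group M) (aut_topology M)) (L0_topology (aut_topology M) d)
                  (L0_const (aut_topology M) g) b \<and>
                freely_generate (L0_group (aut_group M) (aut_topology M))
                  (L0_const (aut_topology M) g) b)))"
proof -
  note g = \<open>g \<in> automorphisms M\<close>
  have am: "conjugates_amalgamate M g"
    unfolding conjugates_amalgamate_def by (intro allI impI assms(3)) auto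
  have P: "\<exists>b. cyclically_generates
        (power_group n (aut_group M)) (power_topology n (aut_topology M)) (\<lambda>i\<in>{1..n}. g) b \<and>
      (no_algebraicity M \<and> no_cycles g \<longrightarrow>
        freely_generate (power_group n (aut_group M)) (\<lambda>i\<in>{1..n}. g) b)" if "n \<ge> 1" for n
    by (rule power_group_generic[OF am g that]) blast
  have L: "\<exists>b. cyclically_generates
        (L0_aut M) (L0_topology (aut_topology M) d) (L0_const (aut_topology M) g) b \<and>
      (no_algebraicity M \<and> no_cycles g \<longrightarrow>
        freely_generate (L0_aut M) (L0_const (aut_topology M) g) b)"
    if "compatible_complete_metric (aut_topology M) d" for d
    by (rule L0_aut_generic[OF am g that]) blast
  show ?thesis
    using P L by blast
qed

end
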